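(* The scheme $\mathsf{2SVHSS}$ described in the context is semantically secure; that is, for every PPT adversary $\mathcal{A}$, $\mathbf{Adv}^{\mathsf{SS}}_{\mathcal{A},\mathsf{2SVHSS}}(\lambda)\le\mathsf{negl}(\lambda)$.
   Context: **Ring and parameters.** $\lambda$ is the security parameter; $\mathsf{negl}$ denotes a negligible function; $[n]=\{1,\dots,n\}$. $R=\mathbb{Z}[X]/(X^N+1)$ with $N\le\mathsf{poly}(\lambda)$ a power of 2; $R_k=R/kR$. Moduli $p,q\in\mathbb{N}$ (functions of $\lambda$) satisfy $p\mid q$, $p\ge\lambda^{\omega(1)}$, $q/p\ge\lambda^{\omega(1)}$; $r\geq 2$ is an integer (input/output modulus), and the input space is $\mathcal{I}=R_r$. **Encryption scheme PKE.** $\mathcal{D}_{\mathsf{sk}}$ is the distribution on elements of $R$ with coefficients uniform in $\{0,\pm1\}$ subject to exactly $h_{\mathsf{sk}}$ coefficients being non-zero. $\mathcal{D}_{\mathsf{err}}$ is an error distribution with rounded Gaussian coefficients of parameter $\sigma$. - $\mathsf{PKE.Gen}(1^\lambda)$: $a\leftarrow R_q$ uniform, $s\leftarrow\mathcal{D}_{\mathsf{sk}}$, $e\leftarrow\mathcal{D}_{\mathsf{err}}$, $b=as+e\in R_q$; $\mathsf{pk}=(a,b)$, $\mathsf{sk}={\bf s}=(1,s)$. - $\mathsf{PKE.Enc}(\mathsf{pk},m)$, $m\in R_p$: $v\leftarrow\mathcal{D}_{\mathsf{sk}}$, $e_0,e_1\leftarrow\mathcal{D}_{\mathsf{err}}$;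 output $(c_0,c_1)\in R_q^2$ with $c_1=-av+e_0$, $c_0=bv+e_1+(q/p)m$. - $\mathsf{PKE.OKDM}(\mathsf{pk},m,1)=\mathsf{PKE.Enc}(\mathsf{pk},m)$; $\mathsf{PKE.OKDM}(\mathsf{pk},m,2)=\mathsf{PKE.Enc}(\mathsf{pk},0)+(0,(q/p)m)$. $\mathsf{PKE}.\mathbf{OKDM}(\mathsf{pk},m)$ is the pair (matrix in $R_q^{2\times2}$) of these two ciphertexts. Standing assumption (KDM security of PKE, based on Ring-LWE): for every PPT $\mathcal{B}$, $\mathbf{Adv}^{\mathsf{kdm\text{-}ind}}_{\mathcal{B},\mathsf{PKE.OKDM}}(\lambda):=|\Pr[\mathbf{Exp}^{\mathsf{kdm\text{-}ind}}_{\mathcal{B},\mathsf{PKE.OKDM}}(\lambda)=1]-1/2|\le\mathsf{negl}(\lambda)$, where in the experiment $(\mathsf{pk},\mathsf{sk})\leftarrow\mathsf{PKE.Gen}(1^\lambda)$, $\beta\leftarrow\{0,1\}$ is uniform, $\mathcal{B}$ gets $1^\lambda,\mathsf{pk}$ and access to an oracle which on $(x,j)$ (with $x\in R_p$, $j\in[2]$) returns $\mathsf{PKE.OKDM}(\mathsf{pk},x,j)$ if $\beta=0$ and $\mathsf{PKE.Enc}(\mathsf{pk},0)$ otherwise; $\mathcal{B}$ outputs $\beta'$ and the experiment returns 1 iff $\beta'=\beta$. **Scheme 2SVHSS (parts relevant here).** $\mathsf{PRF}:\mathcal{K}\times\mathbb{N}\to R_q^2$ is a pseudorandom function. - $\mathsf{2SVHSS.Gen}(1^\lambda)$: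 $(\mathsf{pk},\mathsf{sk}={\bf s}=(1,s))\leftarrow\mathsf{PKE.Gen}(1^\lambda)$; $\hat s\leftarrow\mathcal{D}_{\mathsf{sk}}$; $\mathsf{vk}=\hat s\cdot{\bf s}=(\hat s,\hat s s)$; uniform ${\bf s}_{1,1},{\bf s}_{1,2}\leftarrow R_q^2$; ${\bf s}_{2,1}=\mathsf{sk}-{\bf s}_{1,1}\bmod q$, ${\bf s}_{2,2}=\mathsf{vk}-{\bf s}_{1,2}\bmod q$; keys $K_1,K_2\leftarrow\mathcal{K}$. Output $\mathsf{pk},\mathsf{vk},(\mathsf{ek}_1,\mathsf{ek}_2)$ with $\mathsf{ek}_b=(K_1,K_2,{\bf s}_{b,1},{\bf s}_{b,2})$ for $b\in[2]$. - $\mathsf{2SVHSS.Enc}(\mathsf{pk},x)$: output ${\bf C}^x\leftarrow\mathsf{PKE}.\mathbf{OKDM}(\mathsf{pk},x)$. (The evaluation and verification algorithms do not enter the semantic security experiment.) **Semantic security.** The experiment $\mathbf{Exp}^{\mathsf{SS}}_{\mathcal{A},\mathsf{2SVHSS}}(1^\lambda)$: $(b,x_0,x_1,\mathsf{state})\leftarrow\mathcal{A}(1^\lambda)$ with $b\in[2]$, $x_0,x_1\in\mathcal{I}$; $\beta\leftarrow\{0,1\}$ uniform; $(\mathsf{pk},\mathsf{vk},(\mathsf{ek}_1,\mathsf{ek}_2))\leftarrow\mathsf{2SVHSS.Gen}(1^\lambda)$; $\mathsf{ct}\leftarrow\mathsf{2SVHSS.Enc}(\mathsf{pk},x_\beta)$;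 $\beta'\leftarrow\mathcal{A}(\mathsf{state},\mathsf{pk},\mathsf{ek}_b,\mathsf{ct})$; return 1 if $\beta'=\beta$, else 0. The advantage is $\mathbf{Adv}^{\mathsf{SS}}_{\mathcal{A},\mathsf{2SVHSS}}(\lambda):=|\Pr[\mathbf{Exp}^{\mathsf{SS}}_{\mathcal{A},\mathsf{2SVHSS}}(1^\lambda)=1]-1/2|$. *)

theory Defs
  imports
    "HOL-Probability.Probability"
    "HOL-Computational_Algebra.Polynomial"
    "HOL-Library.Discrete_Functions"
    "HOL-Library.Monad_Syntax"
begin

section \<open>Probabilistic polynomial time\<close>

text \<open>
  The model of computation is a deterministic \<^emph>\<open>while\<close> language over binary trees with natural
  numbers at the leaves, extended by uniform sampling and by queries to an oracle.  Running time is
  charged logarithmically: every node of an evaluated expression costs the bit size of its value.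
\<close>

datatype val = Atom nat | Tup val val

primrec vsize :: "val \<Rightarrow> nat" where
  "vsize (Atom n) = floor_log n + 1"
| "vsize (Tup a b) = vsize a + vsize b + 1"

primrec vnum :: "val \<Rightarrow> nat" where
  "vnum (Atom n) = n"
| "vnum (Tup _ _) = 0"

primrec vfst :: "val \<Rightarrow> val" where
  "vfst (Atom _) = Atom 0"
| "vfst (Tup a _) = a"

primrec vsnd :: "val \<Rightarrow> val" where
  "vsnd (Atom _) = Atom 0"
| "vsnd (Tup _ b) = b"

primrec is_tup :: "val \<Rightarrow> bool" where
  "is_tup (Atom _) \<longleftrightarrow> False"
| "is_tup (Tup _ _) \<longleftrightarrow> True"

datatype expr =
    Var nat
  | Lit val
  | Mk expr expr
  | Fst expr
  | Snd expr
  | IsTup expr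
  | Eq expr expr
  | Less expr expr
  | Add expr expr
  | Sub expr expr
  | Mul expr expr
  | Div expr expr

type_synonym store = "nat \<Rightarrow> val"

primrec eval :: "store \<Rightarrow> expr \<Rightarrow> val" where
  "eval s (Var x) = s x"
| "eval s (Lit v) = v"
| "eval s (Mk d e) = Tup (eval s d) (eval s e)"
| "eval s (Fst e) = vfst (eval s e)"
| "eval s (Snd e) = vsnd (eval s e)"
| "eval s (IsTup e) = Atom (of_bool (is_tup (eval s e)))"
| "eval s (Eq d e) = Atom (of_bool (eval s d = eval s e))"
| "eval s (Less d e) = Atom (of_bool (vnum (eval s d) < vnum (eval s e)))"
| "eval s (Add d e) = Atom (vnum (eval s d) + vnum (eval s e))"
| "eval s (Sub d e) = Atom (vnum (eval s d) - vnum (eval s e))"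
| "eval s (Mul d e) = Atom (vnum (eval s d) * vnum (eval s e))"
| "eval s (Div d e) = Atom (vnum (eval s d) div vnum (eval s e))"

primrec cost :: "store \<Rightarrow> expr \<Rightarrow> nat" where
  "cost s (Var x) = vsize (eval s (Var x))"
| "cost s (Lit v) = vsize (eval s (Lit v))"
| "cost s (Mk d e) = cost s d + cost s e + vsize (eval s (Mk d e))"
| "cost s (Fst e) = cost s e + vsize (eval s (Fst e))"
| "cost s (Snd e) = cost s e + vsize (eval s (Snd e))"
| "cost s (IsTup e) = cost s e + vsize (eval s (IsTup e))"
| "cost s (Eq d e) = cost s d + cost s e + vsize (eval s (Eq d e))"
| "cost s (Less d e) = cost s d + cost s e + vsize (eval s (Less d e))"
| "cost s (Add d e) = cost s d + cost s e + vsize (eval s (Add d e))"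
| "cost s (Sub d e) = cost s d + cost s e + vsize (eval s (Sub d e))"
| "cost s (Mul d e) = cost s d + cost s e + vsize (eval s (Mul d e))"
| "cost s (Div d e) = cost s d + cost s e + vsize (eval s (Div d e))"

text \<open>
  \<open>Sample x e\<close> draws a number below the value of \<open>e\<close>; \<open>Call x c e\<close> runs the subroutine \<open>c\<close> in a
  fresh store.  Every program receives its input, and leaves its output, in register 0.
\<close>

datatype com =
    Assign nat expr
  | Sample nat expr
  | Query nat expr
  | Call nat com expr
  | Seq com com
  | Cond expr com com
  | While expr com

definition init_store :: "val \<Rightarrow> store" where
  "init_store v = (\<lambda>_. Atom 0)(0 := v)"

partial_function (spmf) loop_spmf :: "('s \<Rightarrow> bool) \<Rightarrow> ('s \<Rightarrow> 's spmf) \<Rightarrow> 's \<Rightarrow> 's spmf" where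
  "loop_spmf g body s = (if g s then bind_spmf (body s) (loop_spmf g body) else return_spmf s)"

definition uniform_below :: "nat \<Rightarrow> nat spmf" where
  "uniform_below n = (if n = 0 then return_spmf 0 else spmf_of_set {..<n})"

text \<open>The second component of a configuration is the time consumed so far.\<close>

primrec exec :: "(val \<Rightarrow> val pmf) \<Rightarrow> com \<Rightarrow> store \<times> nat \<Rightarrow> (store \<times> nat) spmf" where
  "exec orc (Assign x e) = (\<lambda>(s, t). return_spmf (s(x := eval s e), t + cost s e))"
| "exec orc (Sample x e) = (\<lambda>(s, t).
     map_spmf (\<lambda>k. (s(x := Atom k), t + cost s e)) (uniform_below (vnum (eval s e))))"
| "exec orc (Query x e) = (\<lambda>(s, t).
     map_spmf (\<lambda>a. (s(x := a), t + cost s e + vsize a)) (spmf_of_pmf (orc (eval s e))))"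
| "exec orc (Call x c e) = (\<lambda>(s, t).
     map_spmf (\<lambda>(s', t'). (s(x := s' 0), t' + vsize (s' 0)))
       (exec orc c (init_store (eval s e), t + cost s e)))"
| "exec orc (Seq c d) = (\<lambda>st. bind_spmf (exec orc c st) (exec orc d))"
| "exec orc (Cond e c d) = (\<lambda>(s, t).
     (if eval s e \<noteq> Atom 0 then exec orc c (s, t + cost s e) else exec orc d (s, t + cost s e)))"
| "exec orc (While e c) = (\<lambda>st.
     map_spmf (\<lambda>(s, t). (s, t + cost s e))
       (loop_spmf (\<lambda>(s, t). eval s e \<noteq> Atom 0) (\<lambda>(s, t). exec orc c (s, t + cost s e)) st))"

definition run :: "(val \<Rightarrow> val pmf) \<Rightarrow> com \<Rightarrow> val \<Rightarrow> (val \<times> nat) spmf" where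
  "run orc c v = map_spmf (\<lambda>(s, t). (s 0, t)) (exec orc c (init_store v, 0))"

definition outcome :: "(val \<Rightarrow> val pmf) \<Rightarrow> com \<Rightarrow> val \<Rightarrow> val spmf" where
  "outcome orc c v = map_spmf fst (run orc c v)"

text \<open>
  Strict polynomial time for oracle machines: the machine halts on every input, for all its coins
  and all oracle answers, within a number of steps polynomial in the length of the input and of the
  longest oracle answer.
\<close>

definition ppt_oracle :: "com \<Rightarrow> bool" where
  "ppt_oracle c \<longleftrightarrow> (\<exists>P :: nat poly. \<forall>v L orc.
     (\<forall>w. \<forall>a \<in> set_pmf (orc w). vsize a \<le> L) \<longrightarrow>
     lossless_spmf (run orc c v) \<and> (\<forall>(a, t) \<in> set_spmf (run orc c v). t \<le> poly P (vsize v + L)))"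

primrec query_free :: "com \<Rightarrow> bool" where
  "query_free (Assign x e) \<longleftrightarrow> True"
| "query_free (Sample x e) \<longleftrightarrow> True"
| "query_free (Query x e) \<longleftrightarrow> False"
| "query_free (Call x c e) \<longleftrightarrow> query_free c"
| "query_free (Seq c d) \<longleftrightarrow> query_free c \<and> query_free d"
| "query_free (Cond e c d) \<longleftrightarrow> query_free c \<and> query_free d"
| "query_free (While e c) \<longleftrightarrow> query_free c"

definition ppt :: "com \<Rightarrow> bool" where
  "ppt c \<longleftrightarrow> query_free c \<and> ppt_oracle c"

text \<open>The oracle passed to \<open>outcome\<close> here is irrelevant for query-free programs.\<close>

definition result :: "com \<Rightarrow> val \<Rightarrow> val spmf" where
  "result = outcome (\<lambda>_. return_pmf (Atom 0))"

definition enc_list :: "val list \<Rightarrow> val" where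
  "enc_list vs = foldr Tup vs (Atom 0)"

definition unary :: "nat \<Rightarrow> val" where
  "unary \<kappa> = enc_list (replicate \<kappa> (Atom 1))"

definition poly_time_computable :: "(nat \<Rightarrow> val) \<Rightarrow> bool" where
  "poly_time_computable f \<longleftrightarrow>
     (\<exists>c. ppt c \<and> (\<forall>\<kappa>. result c (unary \<kappa>) = return_spmf (f \<kappa>)))"

definition negligible :: "(nat \<Rightarrow> real) \<Rightarrow> bool" where
  "negligible f \<longleftrightarrow> (\<forall>c :: nat. \<forall>\<^sub>F \<kappa> in sequentially. \<bar>f \<kappa>\<bar> \<le> 1 / real \<kappa> ^ c)"

definition superpolynomial :: "(nat \<Rightarrow> real) \<Rightarrow> bool" where
  "superpolynomial f \<longleftrightarrow> (\<forall>c :: nat. \<forall>\<^sub>F \<kappa> in sequentially. real \<kappa> ^ c \<le> f \<kappa>)"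

text \<open>The bit output by a distinguisher.\<close>

definition guess :: "val \<Rightarrow> bool" where
  "guess v \<longleftrightarrow> v = Atom 1"


section \<open>The ring\<close>

text \<open>
  Elements of \<open>R = \<int>[X]/(X\<^sup>N + 1)\<close> are represented by their remainders of degree below \<open>N\<close>, those of
  \<open>R\<^sub>k = R/kR\<close> by such remainders with coefficients in \<open>{0..<k}\<close>.  As \<open>X\<^sup>N + 1\<close> is monic,
  pseudo-remainder and remainder coincide.
\<close>

definition cyclo :: "nat \<Rightarrow> int poly" where
  "cyclo N = monom 1 N + 1"

definition redR :: "nat \<Rightarrow> int poly \<Rightarrow> int poly" where
  "redR N f = pseudo_mod f (cyclo N)"

definition red :: "nat \<Rightarrow> nat \<Rightarrow> int poly \<Rightarrow> int poly" where
  "red N k f = map_poly (\<lambda>c. c mod int k) (redR N f)"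

definition ring_mod :: "nat \<Rightarrow> nat \<Rightarrow> int poly set" where
  "ring_mod N k = {f. degree f < N \<and> (\<forall>i. coeff f i \<in> {0..<int k})}"

lemma degree_cyclo: "0 < N \<Longrightarrow> degree (cyclo N) = N"
  unfolding cyclo_def by (subst degree_add_eq_left) (auto simp: degree_monom_eq)

lemma lead_coeff_cyclo: "0 < N \<Longrightarrow> coeff (cyclo N) N = 1"
  by (simp add: cyclo_def)

lemma redR_cong:
  assumes "0 < N"
  shows "cyclo N dvd f - redR N f" and "degree (redR N f) < N"
proof -
  have nz: "cyclo N \<noteq> 0" using degree_cyclo[OF assms] assms by auto
  obtain d r where dr: "pseudo_divmod f (cyclo N) = (d, r)" by force
  have r: "redR N f = r" by (simp add: redR_def pseudo_mod_def dr)
  from pseudo_divmod(1)[OF nz dr] have "f = cyclo N * d + r"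
    by (simp add: degree_cyclo lead_coeff_cyclo assms)
  then have "f - redR N f = cyclo N * d" unfolding r by (metis add_diff_cancel_right')
  then show "cyclo N dvd f - redR N f" by simp
  show "degree (redR N f) < N"
    using pseudo_divmod(2)[OF nz dr] assms by (auto simp: r degree_cyclo)
qed

lemma red_in_ring_mod:
  assumes "0 < N" "0 < k"
  shows "red N k f \<in> ring_mod N k"
proof -
  have "degree (red N k f) \<le> degree (redR N f)"
    by (rule degree_le) (simp add: red_def coeff_map_poly coeff_eq_0)
  with redR_cong(2)[OF assms(1), of f] assms show ?thesis
    by (simp add: ring_mod_def red_def coeff_map_poly)
qed

lemma red_cong:
  assumes "0 < N"
  shows "\<exists>g h. f - red N k f = cyclo N * g + smult (int k) h"
proof -
  obtain g where g: "f - redR N f = cyclo N * g" using redR_cong(1)[OF assms] by (auto elim: dvdE)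
  have "redR N f - red N k f = smult (int k) (map_poly (\<lambda>c. c div int k) (redR N f))"
    by (rule poly_eqI) (simp add: red_def coeff_map_poly minus_mod_eq_mult_div)
  with g have "f - red N k f = cyclo N * g + smult (int k) (map_poly (\<lambda>c. c div int k) (redR N f))"
    by (simp add: algebra_simps)
  then show ?thesis by blast
qed

definition enc_ring :: "nat \<Rightarrow> int poly \<Rightarrow> val" where
  "enc_ring N f = enc_list (map (\<lambda>i. Atom (nat (coeff f i))) [0..<N])"

primrec dec_coeffs :: "val \<Rightarrow> int list" where
  "dec_coeffs (Atom _) = []"
| "dec_coeffs (Tup v w) = int (vnum v) # dec_coeffs w"

definition dec_ring :: "val \<Rightarrow> int poly" where
  "dec_ring v = Poly (dec_coeffs v)"

lemma dec_enc_ring: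
  assumes "f \<in> ring_mod N k"
  shows "dec_ring (enc_ring N f) = f"
proof -
  have *: "dec_coeffs (foldr Tup (map (\<lambda>i. Atom (nat (coeff f i))) xs) (Atom 0)) = map (coeff f) xs"
    for xs using assms by (induction xs) (auto simp: ring_mod_def)
  have "coeff f i = 0" if "\<not> i < N" for i
    using assms that by (auto simp: ring_mod_def intro: coeff_eq_0)
  then show ?thesis
    by (intro poly_eqI) (auto simp: dec_ring_def enc_ring_def enc_list_def * nth_default_def)
qed

definition enc_pair :: "nat \<Rightarrow> int poly \<times> int poly \<Rightarrow> val" where
  "enc_pair N = (\<lambda>(f, g). Tup (enc_ring N f) (enc_ring N g))"


section \<open>The encryption scheme\<close>

record params =
  dim :: nat        \<comment> \<open>\<open>N\<close>\<close>
  ptmod :: nat      \<comment> \<open>\<open>p\<close>\<close>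
  ctmod :: nat      \<comment> \<open>\<open>q\<close>\<close>
  iomod :: nat      \<comment> \<open>\<open>r\<close>\<close>
  weight :: nat     \<comment> \<open>\<open>h\<^sub>s\<^sub>k\<close>\<close>
  width :: real     \<comment> \<open>\<open>\<sigma>\<close>\<close>

abbreviation Rq :: "params \<Rightarrow> int poly set" where "Rq par \<equiv> ring_mod (dim par) (ctmod par)"
abbreviation Rr :: "params \<Rightarrow> int poly set" where "Rr par \<equiv> ring_mod (dim par) (iomod par)"
abbreviation modq :: "params \<Rightarrow> int poly \<Rightarrow> int poly" where "modq par \<equiv> red (dim par) (ctmod par)"
abbreviation modp :: "params \<Rightarrow> int poly \<Rightarrow> int poly" where "modp par \<equiv> red (dim par) (ptmod par)"

definition D_sk :: "params \<Rightarrow> int poly pmf" where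
  "D_sk par = pmf_of_set {f. degree f < dim par \<and> (\<forall>i. coeff f i \<in> {-1, 0, 1})
     \<and> card {i. coeff f i \<noteq> 0} = weight par}"

definition rounded_gaussian :: "real \<Rightarrow> int pmf" where
  "rounded_gaussian \<sigma> = Abs_pmf (distr (density lborel (normal_density 0 \<sigma>)) (count_space UNIV) round)"

lemma measurable_round: "(round :: real \<Rightarrow> int) \<in> borel \<rightarrow>\<^sub>M count_space UNIV"
  unfolding round_def by measurable

lemma measure_pmf_rounded_gaussian:
  assumes "0 < \<sigma>"
  shows "measure_pmf (rounded_gaussian \<sigma>) =
    distr (density lborel (normal_density 0 \<sigma>)) (count_space UNIV) round" (is "_ = ?M")
proof -
  interpret G: prob_space "density lborel (normal_density 0 \<sigma>)"
    using assms by (rule prob_space_normal_density)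
  interpret M: prob_space ?M
    by (rule G.prob_space_distr) (simp add: measurable_round)
  have "AE x in ?M. measure ?M {x} \<noteq> 0"
    by (subst M.AE_support_countable) (auto intro: exI[of _ UNIV])
  then show ?thesis
    unfolding rounded_gaussian_def using M.prob_space_axioms by (intro Abs_pmf_inverse) auto
qed

definition D_err :: "params \<Rightarrow> int poly pmf" where
  "D_err par = map_pmf (\<lambda>f. Poly (map f [0..<dim par]))
     (Pi_pmf {..<dim par} 0 (\<lambda>_. rounded_gaussian (width par)))"

type_synonym ct = "int poly \<times> int poly"

definition add_ct :: "params \<Rightarrow> ct \<Rightarrow> ct \<Rightarrow> ct" where
  "add_ct par = (\<lambda>(c0, c1) (d0, d1). (modq par (c0 + d0), modq par (c1 + d1)))"

text \<open>\<open>q/p\<close> as a scalar.\<close>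

definition scale :: "params \<Rightarrow> int" where
  "scale par = int (ctmod par div ptmod par)"

definition pke_gen :: "params \<Rightarrow> ((int poly \<times> int poly) \<times> (int poly \<times> int poly)) pmf" where
  "pke_gen par = do {
     a \<leftarrow> pmf_of_set (Rq par);
     s \<leftarrow> D_sk par;
     e \<leftarrow> D_err par;
     let b = modq par (a * s + e);
     return_pmf ((a, b), (1, s))
   }"

definition pke_enc :: "params \<Rightarrow> int poly \<times> int poly \<Rightarrow> int poly \<Rightarrow> ct pmf" where
  "pke_enc par = (\<lambda>(a, b) m. do {
     v \<leftarrow> D_sk par;
     e0 \<leftarrow> D_err par;
     e1 \<leftarrow> D_err par;
     let c1 = modq par (- a * v + e0);
     let c0 = modq par (b * v + e1 + smult (scale par) m);
     return_pmf (c0, c1)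
   })"

definition pke_okdm :: "params \<Rightarrow> int poly \<times> int poly \<Rightarrow> int poly \<Rightarrow> nat \<Rightarrow> ct pmf" where
  "pke_okdm par pk m j =
     (if j = 1 then pke_enc par pk m
      else map_pmf (\<lambda>c. add_ct par c (0, smult (scale par) m)) (pke_enc par pk 0))"

definition pke_OKDM :: "params \<Rightarrow> int poly \<times> int poly \<Rightarrow> int poly \<Rightarrow> (ct \<times> ct) pmf" where
  "pke_OKDM par pk m = pair_pmf (pke_okdm par pk m 1) (pke_okdm par pk m 2)"


subsection \<open>KDM security\<close>

text \<open>
  The oracle expects \<open>(x, j)\<close> with \<open>x \<in> R\<^sub>p\<close>, given by any list of coefficients representing it, and
  \<open>j \<in> {1, 2}\<close>; malformed queries are rejected.
\<close>

definition kdm_oracle :: "params \<Rightarrow> int poly \<times> int poly \<Rightarrow> bool \<Rightarrow> val \<Rightarrow> val pmf" where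
  "kdm_oracle par pk \<beta> w =
     (if vsnd w \<in> {Atom 1, Atom 2} then
        map_pmf (enc_pair (dim par))
          (if \<not> \<beta> then pke_okdm par pk (modp par (dec_ring (vfst w))) (vnum (vsnd w))
           else pke_enc par pk 0)
      else return_pmf (Atom 0))"

definition kdm_exp :: "(nat \<Rightarrow> params) \<Rightarrow> com \<Rightarrow> nat \<Rightarrow> bool spmf" where
  "kdm_exp par B \<kappa> = do {
     (pk, sk) \<leftarrow> spmf_of_pmf (pke_gen (par \<kappa>));
     \<beta> \<leftarrow> coin_spmf;
     v \<leftarrow> outcome (kdm_oracle (par \<kappa>) pk \<beta>) B (Tup (unary \<kappa>) (enc_pair (dim (par \<kappa>)) pk));
     return_spmf (guess v = \<beta>)
   }"

definition kdm_adv :: "(nat \<Rightarrow> params) \<Rightarrow> com \<Rightarrow> nat \<Rightarrow> real" where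
  "kdm_adv par B \<kappa> = \<bar>spmf (kdm_exp par B \<kappa>) True - 1 / 2\<bar>"

definition kdm_secure :: "(nat \<Rightarrow> params) \<Rightarrow> bool" where
  "kdm_secure par \<longleftrightarrow> (\<forall>B. ppt_oracle B \<longrightarrow> negligible (kdm_adv par B))"


section \<open>Pseudorandom functions into pairs of ring elements\<close>

definition fun_oracle :: "params \<Rightarrow> (nat \<Rightarrow> int poly \<times> int poly) \<Rightarrow> val \<Rightarrow> val pmf" where
  "fun_oracle par f w =
     (if is_tup w then return_pmf (Atom 0) else return_pmf (enc_pair (dim par) (f (vnum w))))"

definition prf_real :: "(nat \<Rightarrow> params) \<Rightarrow> (nat \<Rightarrow> val set) \<Rightarrow> (nat \<Rightarrow> val \<Rightarrow> nat \<Rightarrow> int poly \<times> int poly)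
    \<Rightarrow> com \<Rightarrow> nat \<Rightarrow> real" where
  "prf_real par KS F D \<kappa> =
     spmf (do {
       k \<leftarrow> spmf_of_set (KS \<kappa>);
       v \<leftarrow> outcome (fun_oracle (par \<kappa>) (F \<kappa> k)) D (unary \<kappa>);
       return_spmf (guess v)
     }) True"

text \<open>
  A uniformly random function on \<open>\<nat>\<close> is not a discrete object, hence the integral over the infinite
  product measure.
\<close>

definition prf_ideal :: "(nat \<Rightarrow> params) \<Rightarrow> com \<Rightarrow> nat \<Rightarrow> real" where
  "prf_ideal par D \<kappa> =
     (LINT f | Pi\<^sub>M UNIV (\<lambda>_ :: nat. measure_pmf (pmf_of_set (Rq (par \<kappa>) \<times> Rq (par \<kappa>)))).
       spmf (map_spmf guess (outcome (fun_oracle (par \<kappa>) f) D (unary \<kappa>))) True)"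

definition pseudorandom_function ::
  "(nat \<Rightarrow> params) \<Rightarrow> (nat \<Rightarrow> val set) \<Rightarrow> (nat \<Rightarrow> val \<Rightarrow> nat \<Rightarrow> int poly \<times> int poly) \<Rightarrow> bool" where
  "pseudorandom_function par KS F \<longleftrightarrow>
     (\<forall>\<kappa>. finite (KS \<kappa>) \<and> KS \<kappa> \<noteq> {}) \<and>
     (\<forall>\<kappa>. \<forall>k \<in> KS \<kappa>. \<forall>n. F \<kappa> k n \<in> Rq (par \<kappa>) \<times> Rq (par \<kappa>)) \<and>
     (\<exists>c. ppt c \<and> (\<forall>\<kappa>. result c (unary \<kappa>) = spmf_of_set (KS \<kappa>))) \<and>
     (\<exists>c. ppt c \<and> (\<forall>\<kappa>. \<forall>k \<in> KS \<kappa>. \<forall>n. result c (Tup (unary \<kappa>) (Tup k (Atom n)))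
                                        = return_spmf (enc_pair (dim (par \<kappa>)) (F \<kappa> k n)))) \<and>
     (\<forall>D. ppt_oracle D \<longrightarrow> negligible (\<lambda>\<kappa>. \<bar>prf_real par KS F D \<kappa> - prf_ideal par D \<kappa>\<bar>))"


section \<open>The homomorphic secret sharing scheme\<close>

type_synonym ek = "val \<times> val \<times> (int poly \<times> int poly) \<times> (int poly \<times> int poly)"

definition sub_pair :: "params \<Rightarrow> int poly \<times> int poly \<Rightarrow> int poly \<times> int poly \<Rightarrow> int poly \<times> int poly" where
  "sub_pair par = (\<lambda>(f, g) (f', g'). (modq par (f - f'), modq par (g - g')))"

definition hss_gen ::
  "params \<Rightarrow> val set \<Rightarrow> ((int poly \<times> int poly) \<times> (int poly \<times> int poly) \<times> (ek \<times> ek)) pmf" where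
  "hss_gen par Keys = do {
     (pk, sk) \<leftarrow> pke_gen par;
     s' \<leftarrow> D_sk par;
     let vk = (redR (dim par) (s' * fst sk), redR (dim par) (s' * snd sk));
     s11 \<leftarrow> pmf_of_set (Rq par \<times> Rq par);
     s12 \<leftarrow> pmf_of_set (Rq par \<times> Rq par);
     let s21 = sub_pair par sk s11;
     let s22 = sub_pair par vk s12;
     K1 \<leftarrow> pmf_of_set Keys;
     K2 \<leftarrow> pmf_of_set Keys;
     return_pmf (pk, vk, ((K1, K2, s11, s12), (K1, K2, s21, s22)))
   }"

text \<open>An input from \<open>R\<^sub>r\<close> is encrypted as the class in \<open>R\<^sub>p\<close> of its representative.\<close>

definition hss_enc :: "params \<Rightarrow> int poly \<times> int poly \<Rightarrow> int poly \<Rightarrow> (ct \<times> ct) pmf" where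
  "hss_enc par pk x = pke_OKDM par pk (modp par x)"

definition enc_ek :: "params \<Rightarrow> ek \<Rightarrow> val" where
  "enc_ek par = (\<lambda>(K1, K2, s, t).
     Tup K1 (Tup K2 (Tup (enc_pair (dim par) s) (enc_pair (dim par) t))))"

definition enc_cts :: "params \<Rightarrow> ct \<times> ct \<Rightarrow> val" where
  "enc_cts par = (\<lambda>(c, d). Tup (enc_pair (dim par) c) (enc_pair (dim par) d))"


subsection \<open>Semantic security\<close>

text \<open>
  An adversary consists of two programs, one for each stage; the first one has to output a tuple
  \<open>(b, x\<^sub>0, x\<^sub>1, state)\<close> with \<open>b \<in> {1, 2}\<close> and \<open>x\<^sub>0, x\<^sub>1 \<in> R\<^sub>r\<close>.
\<close>

definition ss_adversary :: "(nat \<Rightarrow> params) \<Rightarrow> com \<Rightarrow> com \<Rightarrow> bool" where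
  "ss_adversary par A1 A2 \<longleftrightarrow> ppt A1 \<and> ppt A2 \<and>
     (\<forall>\<kappa>. \<forall>u \<in> set_spmf (result A1 (unary \<kappa>)). \<exists>b x0 x1 st.
        u = Tup (Atom b) (Tup (enc_ring (dim (par \<kappa>)) x0) (Tup (enc_ring (dim (par \<kappa>)) x1) st)) \<and>
        b \<in> {1, 2} \<and> x0 \<in> Rr (par \<kappa>) \<and> x1 \<in> Rr (par \<kappa>))"

definition ss_exp :: "(nat \<Rightarrow> params) \<Rightarrow> (nat \<Rightarrow> val set) \<Rightarrow> com \<Rightarrow> com \<Rightarrow> nat \<Rightarrow> bool spmf" where
  "ss_exp par KS A1 A2 \<kappa> = do {
     u \<leftarrow> result A1 (unary \<kappa>);
     let b = vnum (vfst u);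
     let x0 = dec_ring (vfst (vsnd u));
     let x1 = dec_ring (vfst (vsnd (vsnd u)));
     let st = vsnd (vsnd (vsnd u));
     \<beta> \<leftarrow> coin_spmf;
     (pk, vk, (ek1, ek2)) \<leftarrow> spmf_of_pmf (hss_gen (par \<kappa>) (KS \<kappa>));
     ct \<leftarrow> spmf_of_pmf (hss_enc (par \<kappa>) pk (if \<beta> then x1 else x0));
     v \<leftarrow> result A2 (Tup st (Tup (enc_pair (dim (par \<kappa>)) pk)
            (Tup (enc_ek (par \<kappa>) (if b = 1 then ek1 else ek2)) (enc_cts (par \<kappa>) ct))));
     return_spmf (guess v = \<beta>)
   }"

definition ss_adv :: "(nat \<Rightarrow> params) \<Rightarrow> (nat \<Rightarrow> val set) \<Rightarrow> com \<Rightarrow> com \<Rightarrow> nat \<Rightarrow> real" where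
  "ss_adv par KS A1 A2 \<kappa> = \<bar>spmf (ss_exp par KS A1 A2 \<kappa>) True - 1 / 2\<bar>"

definition semantically_secure :: "(nat \<Rightarrow> params) \<Rightarrow> (nat \<Rightarrow> val set) \<Rightarrow> bool" where
  "semantically_secure par KS \<longleftrightarrow>
     (\<forall>A1 A2. ss_adversary par A1 A2 \<longrightarrow> negligible (ss_adv par KS A1 A2))"


section \<open>Parameters\<close>

definition admissible_params :: "(nat \<Rightarrow> params) \<Rightarrow> bool" where
  "admissible_params par \<longleftrightarrow>
     (\<forall>\<kappa>. \<exists>k. dim (par \<kappa>) = 2 ^ k) \<and>
     (\<exists>P :: nat poly. \<forall>\<kappa>. dim (par \<kappa>) \<le> poly P \<kappa>) \<and>
     (\<forall>\<kappa>. 0 < ptmod (par \<kappa>) \<and> 0 < ctmod (par \<kappa>) \<and> ptmod (par \<kappa>) dvd ctmod (par \<kappa>)) \<and>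
     superpolynomial (\<lambda>\<kappa>. real (ptmod (par \<kappa>))) \<and>
     superpolynomial (\<lambda>\<kappa>. real (ctmod (par \<kappa>)) / real (ptmod (par \<kappa>))) \<and>
     (\<forall>\<kappa>. 2 \<le> iomod (par \<kappa>)) \<and>
     (\<forall>\<kappa>. weight (par \<kappa>) \<le> dim (par \<kappa>)) \<and>
     (\<forall>\<kappa>. 0 < width (par \<kappa>))"

text \<open>
  The integer parameters are public and known to all algorithms, i.e. they can be computed from the
  security parameter; in particular the moduli have polynomially many bits.
\<close>

definition public_params :: "(nat \<Rightarrow> params) \<Rightarrow> bool" where
  "public_params par \<longleftrightarrow> poly_time_computable (\<lambda>\<kappa>. enc_list (map Atom
     [dim (par \<kappa>), ptmod (par \<kappa>), ctmod (par \<kappa>), iomod (par \<kappa>), weight (par \<kappa>)]))"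

end

theory Submission
  imports Defs
begin

text \<open>
  The reduction runs the adversary itself: it asks its KDM oracle for the two ciphertexts of a
  randomly chosen \<open>x\<^sub>\<beta>\<close> and replaces the share of the evaluation key by uniform ring elements, which is
  perfect because one share alone is uniform and independent of the secret key.  It answers that the
  oracle is fake exactly if the adversary misses \<open>\<beta>\<close>.  With a real oracle this is the semantic security
  experiment, with a fake one \<open>\<beta>\<close> is hidden perfectly, so the KDM advantage is half the advantage of
  the adversary.
\<close>

section \<open>Executions\<close>

text \<open>Much of the work lies in showing that the reduction is an efficient KDM adversary.
  Polynomial time is strict: it must hold on every input, malformed ones included, and for every
  oracle, so a look at honest runs is not enough. The time bound is therefore strengthened to a
  property of commands started in arbitrary stores. Closure is proved for every construct except the
  loop; the single loop written here, the sampler for uniform ring elements, is bounded by hand. The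
  adversary, the key sampler and the program computing the parameters are known only by their
  input-output behaviour and enter through \<open>Call\<close>. Both ciphertexts come from the
  oracle, so the reduction never has to produce secrets or Gaussian noise; besides the keys it draws
  only the challenge bit and elements of \<open>Rq\<close>. All comparisons of games are equalities
  of distributions, so the two advantages are related exactly at each \<kappa>, with no hybrid
  losses.\<close>

text \<open>A loop is a least fixed point, so each of the two inequalities follows by fixed point
  induction on the loop standing on its left. The use is to push a change of the clock through
  \<open>While\<close>.\<close>

lemma map_loop_spmf:
  assumes g: "\<And>s. g' (h s) = g s"
    and body: "\<And>s. g s \<Longrightarrow> body' (h s) = map_spmf h (body s)"
  shows "loop_spmf g' body' (h s) = map_spmf h (loop_spmf g body s)"
proof (rule spmf.leq_antisym)
  have "\<forall>s. ord_spmf (=) (loop_spmf g' body' (h s)) (map_spmf h (loop_spmf g body s))"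
  proof (induction rule: loop_spmf.fixp_induct[where P = "\<lambda>l. \<forall>s. ord_spmf (=) (l g' body' (h s)) (map_spmf h (loop_spmf g body s))"])
    case 1
    show ?case by simp
  next
    case 2
    show ?case by simp
  next
    case (3 l)
    show ?case
    proof
      fix s
      show "ord_spmf (=) (if g' (h s) then bind_spmf (body' (h s)) (l g' body') else return_spmf (h s))
          (map_spmf h (loop_spmf g body s))"
        by (subst loop_spmf.simps)
          (auto simp: g body map_spmf_bind_spmf bind_map_spmf intro!: ord_spmf_bind_reflI 3[rule_format])
    qed
  qed
  then show "ord_spmf (=) (loop_spmf g' body' (h s)) (map_spmf h (loop_spmf g body s))" ..
next
  have "\<forall>s. ord_spmf (=) (map_spmf h (loop_spmf g body s)) (loop_spmf g' body' (h s))"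
  proof (induction rule: loop_spmf.fixp_induct[where P = "\<lambda>l. \<forall>s. ord_spmf (=) (map_spmf h (l g body s)) (loop_spmf g' body' (h s))"])
    case 1
    show ?case by simp
  next
    case 2
    show ?case by simp
  next
    case (3 l)
    show ?case
    proof
      fix s
      show "ord_spmf (=) (map_spmf h (if g s then bind_spmf (body s) (l g body) else return_spmf s))
          (loop_spmf g' body' (h s))"
        by (subst loop_spmf.simps)
          (auto simp: g body map_spmf_bind_spmf bind_map_spmf intro!: ord_spmf_bind_reflI 3[rule_format])
    qed
  qed
  then show "ord_spmf (=) (map_spmf h (loop_spmf g body s)) (loop_spmf g' body' (h s))" ..
qed

text \<open>Partial correctness by fixed point induction; termination is not addressed here.\<close>

lemma loop_spmf_invariant:
  assumes body: "\<And>s s'. \<lbrakk>g s; I s; s' \<in> set_spmf (body s)\<rbrakk> \<Longrightarrow> I s'"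
    and "I s"
  shows "\<forall>s' \<in> set_spmf (loop_spmf g body s). I s'"
proof -
  have "\<forall>s. I s \<longrightarrow> (\<forall>s' \<in> set_spmf (loop_spmf g body s). I s')"
  proof (induction rule: loop_spmf.fixp_induct[where P = "\<lambda>l. \<forall>s. I s \<longrightarrow> (\<forall>s' \<in> set_spmf (l g body s). I s')"])
    case 1
    show ?case by simp
  next
    case 2
    show ?case by simp
  next
    case (3 l)
    then show ?case by (auto simp: set_bind_spmf) (meson body)
  qed
  with \<open>I s\<close> show ?thesis by blast
qed

text \<open>Programs cannot read the clock. Hence time bounds may be stated for clock 0 only, and
  the distribution of final stores does not depend on the initial clock.\<close>

lemma exec_shift: "exec orc c (s, t + d) = map_spmf (apsnd (\<lambda>u. u + d)) (exec orc c (s, t))"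
proof (induction c arbitrary: s t)
  case (Seq c1 c2)
  have *: "exec orc c2 (apsnd (\<lambda>u. u + d) st) = map_spmf (apsnd (\<lambda>u. u + d)) (exec orc c2 st)" for st
    by (cases st) (simp add: Seq.IH)
  show ?case by (simp add: Seq.IH map_spmf_bind_spmf bind_map_spmf o_def *)
next
  case (While e c)
  have *: "map_spmf (\<lambda>(s, t). (s, t + cost s e)) \<circ> map_spmf (apsnd (\<lambda>u. u + d)) =
    map_spmf (apsnd (\<lambda>u. u + d)) \<circ> map_spmf (\<lambda>(s, t). (s, t + cost s e))"
    by (auto simp: fun_eq_iff spmf.map_comp intro!: map_spmf_cong)
  have "exec orc c (s, t + d + cost s e) = map_spmf (apsnd (\<lambda>u. u + d)) (exec orc c (s, t + cost s e))" for s t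
    using While.IH[of s "t + cost s e"] by (simp add: ac_simps)
  then have "loop_spmf (\<lambda>(s, t). eval s e \<noteq> Atom 0) (\<lambda>(s, t). exec orc c (s, t + cost s e))
       (apsnd (\<lambda>u. u + d) (s, t)) = map_spmf (apsnd (\<lambda>u. u + d))
       (loop_spmf (\<lambda>(s, t). eval s e \<noteq> Atom 0) (\<lambda>(s, t). exec orc c (s, t + cost s e)) (s, t))"
    by (intro map_loop_spmf) auto
  with * show ?case by (simp add: fun_eq_iff)
next
  case (Call x c e)
  have "exec orc c (init_store (eval s e), t + d + cost s e) =
     map_spmf (apsnd (\<lambda>u. u + d)) (exec orc c (init_store (eval s e), t + cost s e))"
    using Call[of "init_store (eval s e)" "t + cost s e"] by (simp add: ac_simps)
  then show ?case by (auto simp: spmf.map_comp intro!: map_spmf_cong)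
next
  case (Cond e c1 c2)
  show ?case
    using Cond.IH(1)[of s "t + cost s e"] Cond.IH(2)[of s "t + cost s e"] by (simp add: ac_simps)
qed (auto simp: spmf.map_comp pmf.map_comp option.map_comp o_def add_ac simp flip: map_spmf_of_pmf intro!: map_spmf_cong pmf.map_cong)

lemma exec_query_free: "query_free c \<Longrightarrow> exec orc c = exec orc' c"
  by (induction c) auto

lemma vsize_pos: "0 < vsize v"
  by (cases v) auto

lemma vsize_eval_le_cost: "vsize (eval s e) \<le> cost s e"
  by (cases e) auto

text \<open>Every write to a register is charged at least the size of the value written, so elapsed
  time also bounds sizes. The absolute form \<open>M + t\<close> is an invariant that passes
  unchanged through sequences and loops. It makes polynomial time compose: what a fast command
  leaves behind is a small input for the next one.\<close>

lemma exec_bounds: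
  assumes "(s', t') \<in> set_spmf (exec orc c (s, t))" and "\<And>x. vsize (s x) \<le> M + t"
  shows "t \<le> t' \<and> (\<forall>x. vsize (s' x) \<le> M + t')"
  using assms
proof (induction c arbitrary: s t s' t')
  case (Assign x e)
  then show ?case using vsize_eval_le_cost[of s e]
    by (auto simp: add.assoc[symmetric] intro: trans_le_add1 trans_le_add2)
next
  case (Sample x e)
  have "vsize (Atom k) \<le> cost s e" if "k \<in> set_spmf (uniform_below (vnum (eval s e)))" for k
  \<comment> \<open>\<open>uniform_below 0\<close> returns 0, of size 1, which any positive cost
    covers.\<close>
  proof (cases "vnum (eval s e) = 0")
    case True
    with that show ?thesis using vsize_pos[of "eval s e"] vsize_eval_le_cost[of s e]
      by (auto simp: uniform_below_def)
  next
    case False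
    with that have "k \<le> vnum (eval s e)" by (auto simp: uniform_below_def)
    then show ?thesis using False vsize_eval_le_cost[of s e]
      by (cases "eval s e") (auto dest: floor_log_le_iff)
  qed
  then have "vsize (Atom k) \<le> M + t + cost s e" if "k \<in> set_spmf (uniform_below (vnum (eval s e)))" for k
    using that by (simp add: trans_le_add2 del: vsize.simps)
  with Sample show ?case
    by (auto simp: add.assoc[symmetric] trans_le_add1 simp del: vsize.simps)
next
  case (Query x e)
  then show ?case by (auto simp: add.assoc[symmetric] trans_le_add1 trans_le_add2)
next
  case (Call x c e)
  from Call.prems(1) obtain r u where
    ru: "(r, u) \<in> set_spmf (exec orc c (init_store (eval s e), t + cost s e))"
      "s' = s(x := r 0)" "t' = u + vsize (r 0)" by auto
  \<comment> \<open>The fresh registers hold \<open>Atom 0\<close> of size 1; this fits because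
    \<open>M + t\<close> already bounds the size of some value and is thus positive.\<close>
  have "vsize (init_store (eval s e) y) \<le> M + (t + cost s e)" for y
    using vsize_eval_le_cost[of s e] vsize_pos[of "s 0"] Call.prems(2)[of 0]
    by (auto simp: init_store_def)
  from Call.IH[OF ru(1) this] have "t + cost s e \<le> u" "\<And>y. vsize (r y) \<le> M + u" by auto
  with ru Call.prems(2) show ?case by (fastforce intro: le_trans)
next
  case (Seq c d)
  from Seq.prems(1) obtain r u where "(r, u) \<in> set_spmf (exec orc c (s, t))"
     and 2: "(s', t') \<in> set_spmf (exec orc d (r, u))" by (auto simp: set_bind_spmf)
  from Seq.IH(1)[OF this(1) Seq.prems(2)] Seq.IH(2)[OF 2] show ?case by fastforce
next
  case (Cond e c d)
  have "vsize (s x) \<le> M + (t + cost s e)" for x using Cond.prems(2)[of x] by simp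
  with Cond.prems(1) Cond.IH(1)[of s' t' s "t + cost s e"] Cond.IH(2)[of s' t' s "t + cost s e"]
  show ?case by (auto split: if_splits)
next
  case (While e c)
  let ?I = "\<lambda>(s', t'). t \<le> t' \<and> (\<forall>x. vsize (s' x) \<le> M + t')"
  have "\<forall>st \<in> set_spmf (loop_spmf (\<lambda>(s, t). eval s e \<noteq> Atom 0) (\<lambda>(s, t). exec orc c (s, t + cost s e)) (s, t)). ?I st"
  proof (rule loop_spmf_invariant)
    fix st st'
    assume "?I st" and st': "st' \<in> set_spmf (case st of (s, t) \<Rightarrow> exec orc c (s, t + cost s e))"
    obtain r u r' u' where "st = (r, u)" "st' = (r', u')" by force
    with \<open>?I st\<close> st' While.IH[of r' u' r "u + cost r e"] show "?I st'"
      by (fastforce simp: add.assoc[symmetric] intro: trans_le_add1)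
  qed (use While.prems in auto)
  with While.prems(1) show ?case by (fastforce intro: trans_le_add1 simp: add.assoc[symmetric])
qed

section \<open>Closure of polynomial time under composition\<close>

lemma poly_nat_mono: "x \<le> y \<Longrightarrow> poly p x \<le> poly p (y :: nat)"
  by (induction p) (auto intro: add_mono mult_mono)

lemma vnum_less: "vnum v < 2 ^ vsize v"
  by (cases v) (auto simp: floor_log_exp2_gt)

lemma vsize_Atom_le:
  assumes "n < 2 ^ k" "0 < k"
  shows "vsize (Atom n) \<le> k"
proof (cases "n = 0")
  case False
  then have "2 ^ floor_log n < (2 :: nat) ^ k"
    using floor_log_exp2_le[of n] assms(1) by linarith
  then show ?thesis by simp
qed (use assms in auto)

lemma vsize_Atom_add: "vsize (Atom (vnum a + vnum b)) \<le> vsize a + vsize b + 1"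
proof (rule vsize_Atom_le)
  have "(2 :: nat) ^ vsize a \<le> 2 ^ (vsize a + vsize b)" "(2 :: nat) ^ vsize b \<le> 2 ^ (vsize a + vsize b)"
    by (auto intro: power_increasing)
  then have "vnum a + vnum b < 2 ^ (vsize a + vsize b) + 2 ^ (vsize a + vsize b)"
    using vnum_less[of a] vnum_less[of b] by linarith
  then show "vnum a + vnum b < 2 ^ (vsize a + vsize b + 1)" by simp
qed simp

lemma vsize_Atom_mult: "vsize (Atom (vnum a * vnum b)) \<le> vsize a + vsize b + 1"
proof (rule vsize_Atom_le)
  have "vnum a * vnum b < 2 ^ vsize a * 2 ^ vsize b"
    by (rule mult_strict_mono) (auto simp: vnum_less)
  also have "\<dots> \<le> 2 ^ (vsize a + vsize b + 1)" by (simp add: power_add)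
  finally show "vnum a * vnum b < 2 ^ (vsize a + vsize b + 1)" .
qed simp

lemma vsize_Atom_le_vnum: "n \<le> vnum v \<Longrightarrow> vsize (Atom n) \<le> vsize v"
  using vnum_less[of v] vsize_pos[of v] by (intro vsize_Atom_le) auto

lemma vsize_vfst: "vsize (vfst v) \<le> vsize v" and vsize_vsnd: "vsize (vsnd v) \<le> vsize v"
  by (cases v; simp)+

lemma vsize_bool: "vsize (Atom (of_bool b)) = 1"
  by (cases b) auto

text \<open>Every operator, multiplication included, yields a result no larger than its operands
  together plus one. Thus a node costs at most twice its operands plus one: once for evaluating
  them, once for the result. The factor compounds with depth, but the expression is fixed.\<close>

lemma cost_poly: "\<exists>P. \<forall>s M. (\<forall>x. vsize (s x) \<le> M) \<longrightarrow> cost s e \<le> poly P M"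
proof -
  let ?B = "\<lambda>e P. \<forall>s M. (\<forall>x. vsize (s x) \<le> M) \<longrightarrow> cost s e \<le> poly P M"
  have un: "\<exists>P. ?B e P" if "\<exists>P. ?B d P" and "\<And>s. cost s e \<le> 2 * cost s d + 1" for d e
  proof -
    from that(1) obtain P where P: "?B d P" by blast
    have "?B e (2 * P + 1)"
    proof (intro allI impI)
      fix s :: store and M assume "\<forall>x. vsize (s x) \<le> M"
      with P have "cost s d \<le> poly P M" by blast
      with that(2)[of s] show "cost s e \<le> poly (2 * P + 1) M" by simp
    qed
    then show ?thesis by blast
  qed
  have bin: "\<exists>P. ?B e P"
    if "\<exists>P. ?B d P" "\<exists>P. ?B d' P" and "\<And>s. cost s e \<le> 2 * cost s d + 2 * cost s d' + 1" for d d' e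
  proof -
    from that(1,2) obtain P Q where P: "?B d P" and Q: "?B d' Q" by blast
    have "?B e (2 * P + 2 * Q + 1)"
    proof (intro allI impI)
      fix s :: store and M assume "\<forall>x. vsize (s x) \<le> M"
      with P Q have "cost s d \<le> poly P M" "cost s d' \<le> poly Q M" by blast+
      with that(3)[of s] show "cost s e \<le> poly (2 * P + 2 * Q + 1) M" by simp
    qed
    then show ?thesis by blast
  qed
  show ?thesis
  proof (induction e)
    case (Var x)
    show ?case by (rule exI[of _ "[:0, 1:]"]) simp
  next
    case (Lit v)
    show ?case by (rule exI[of _ "[:vsize v:]"]) simp
  next
    case (Mk d e)
    show ?case
      by (rule bin[OF Mk]) (use vsize_eval_le_cost in \<open>auto intro!: add_mono simp: mult_2\<close>)
  next
    case (Fst e)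
    show ?case
    proof (rule un[OF Fst])
      show "cost s (Fst e) \<le> 2 * cost s e + 1" for s
        using vsize_vfst[of "eval s e"] vsize_eval_le_cost[of s e] by simp
    qed
  next
    case (Snd e)
    show ?case
    proof (rule un[OF Snd])
      show "cost s (Snd e) \<le> 2 * cost s e + 1" for s
        using vsize_vsnd[of "eval s e"] vsize_eval_le_cost[of s e] by simp
    qed
  next
    case (IsTup e)
    show ?case by (rule un[OF IsTup]) (simp del: vsize.simps add: vsize_bool)
  next
    case (Eq d e)
    show ?case by (rule bin[OF Eq]) (simp del: vsize.simps add: vsize_bool)
  next
    case (Less d e)
    show ?case by (rule bin[OF Less]) (simp del: vsize.simps add: vsize_bool)
  next
    case (Add d e)
    show ?case
    proof (rule bin[OF Add])
      show "cost s (Add d e) \<le> 2 * cost s d + 2 * cost s e + 1" for s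
        using vsize_Atom_add[of "eval s d" "eval s e"] vsize_eval_le_cost[of s d] vsize_eval_le_cost[of s e]
        by simp
    qed
  next
    case (Sub d e)
    show ?case
    proof (rule bin[OF Sub])
      show "cost s (Sub d e) \<le> 2 * cost s d + 2 * cost s e + 1" for s
        using vsize_Atom_le_vnum[of "vnum (eval s d) - vnum (eval s e)" "eval s d"] vsize_eval_le_cost[of s d]
        by simp
    qed
  next
    case (Mul d e)
    show ?case
    proof (rule bin[OF Mul])
      show "cost s (Mul d e) \<le> 2 * cost s d + 2 * cost s e + 1" for s
        using vsize_Atom_mult[of "eval s d" "eval s e"] vsize_eval_le_cost[of s d] vsize_eval_le_cost[of s e]
        by simp
    qed
  next
    case (Div d e)
    show ?case
    proof (rule bin[OF Div])
      show "cost s (Div d e) \<le> 2 * cost s d + 2 * cost s e + 1" for s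
        using vsize_Atom_le_vnum[of "vnum (eval s d) div vnum (eval s e)" "eval s d"] vsize_eval_le_cost[of s d]
        by simp
    qed
  qed
qed

text \<open>\<open>ppt_oracle\<close> speaks of initial stores only and does not pass through
  \<open>Seq\<close>, whose second command starts in whatever store the first one leaves. Hence the
  quantification over all stores with registers of size at most \<open>M\<close>.\<close>

definition time_bound :: "com \<Rightarrow> nat poly \<Rightarrow> bool" where
  "time_bound c P \<longleftrightarrow> (\<forall>orc L s M. (\<forall>w. \<forall>a \<in> set_pmf (orc w). vsize a \<le> L) \<longrightarrow> (\<forall>x. vsize (s x) \<le> M) \<longrightarrow>
     lossless_spmf (exec orc c (s, 0)) \<and> (\<forall>(s', t) \<in> set_spmf (exec orc c (s, 0)). t \<le> poly P (M + L)))"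

definition poly_time :: "com \<Rightarrow> bool" where
  "poly_time c \<longleftrightarrow> (\<exists>P. time_bound c P)"

lemma time_boundD:
  fixes orc :: "val \<Rightarrow> val pmf"
  assumes "time_bound c P" "\<forall>w. \<forall>a \<in> set_pmf (orc w). vsize a \<le> L" "\<forall>x. vsize (s x) \<le> M"
  shows "lossless_spmf (exec orc c (s, t))"
    and "(s', t') \<in> set_spmf (exec orc c (s, t)) \<Longrightarrow> t' \<le> t + poly P (M + L)"
    and "(s', t') \<in> set_spmf (exec orc c (s, t)) \<Longrightarrow> \<forall>x. vsize (s' x) \<le> M + poly P (M + L)"
proof -
  have *: "exec orc c (s, t) = map_spmf (apsnd (\<lambda>u. u + t)) (exec orc c (s, 0))"
    using exec_shift[of orc c s 0 t] by simp
  have L: "lossless_spmf (exec orc c (s, 0))"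
    and B: "\<And>s' t'. (s', t') \<in> set_spmf (exec orc c (s, 0)) \<Longrightarrow> t' \<le> poly P (M + L)"
    using assms unfolding time_bound_def by blast+
  from L show "lossless_spmf (exec orc c (s, t))" by (simp add: *)
  show "t' \<le> t + poly P (M + L)" if "(s', t') \<in> set_spmf (exec orc c (s, t))"
    using that B by (auto simp: *)
  show "\<forall>x. vsize (s' x) \<le> M + poly P (M + L)" if "(s', t') \<in> set_spmf (exec orc c (s, t))"
  proof -
    from that obtain u where u: "(s', u) \<in> set_spmf (exec orc c (s, 0))" by (auto simp: *)
    from exec_bounds[OF u, of M] B[OF u] assms(3) show ?thesis by (auto intro: le_trans)
  qed
qed

lemma poly_timeI:
  assumes "\<And>(orc :: val \<Rightarrow> val pmf) L s M. \<lbrakk>\<forall>w. \<forall>a \<in> set_pmf (orc w). vsize a \<le> L; \<forall>x. vsize (s x) \<le> M\<rbrakk> \<Longrightarrow>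
     lossless_spmf (exec orc c (s, 0)) \<and> (\<forall>(s', t) \<in> set_spmf (exec orc c (s, 0)). t \<le> poly P (M + L))"
  shows "poly_time c"
  using assms unfolding poly_time_def time_bound_def by blast

lemma poly_time_imp_ppt_oracle:
  assumes "poly_time c"
  shows "ppt_oracle c"
proof -
  from assms obtain P where P: "time_bound c P" by (auto simp: poly_time_def)
  have sz: "\<forall>x. vsize (init_store v x) \<le> vsize v" for v
    using vsize_pos[of v] by (auto simp: init_store_def)
  show ?thesis
    unfolding ppt_oracle_def
  proof (intro exI[of _ P] allI impI)
    fix v L and orc :: "val \<Rightarrow> val pmf" assume orc: "\<forall>w. \<forall>a \<in> set_pmf (orc w). vsize a \<le> L"
    note * = time_boundD[OF P orc sz[of v]]
    show "lossless_spmf (run orc c v) \<and> (\<forall>(a, t) \<in> set_spmf (run orc c v). t \<le> poly P (vsize v + L))"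
      using *(1,2) by (fastforce simp: run_def)
  qed
qed

lemma poly_time_Assign: "poly_time (Assign x e)"
proof -
  obtain P where P: "\<And>s M. (\<forall>x. vsize (s x) \<le> M) \<longrightarrow> cost s e \<le> poly P M" using cost_poly by blast
  show ?thesis
  proof (rule poly_timeI[where P = P])
    fix s :: store and M L :: nat assume "\<forall>x. vsize (s x) \<le> M"
    then have "cost s e \<le> poly P M" using P by blast
    also have "\<dots> \<le> poly P (M + L)" by (simp add: poly_nat_mono)
    finally show "lossless_spmf (exec orc (Assign x e) (s, 0)) \<and>
       (\<forall>(s', t) \<in> set_spmf (exec orc (Assign x e) (s, 0)). t \<le> poly P (M + L))" for orc by simp
  qed
qed

lemma lossless_uniform_below [simp]: "lossless_spmf (uniform_below n)"
  by (auto simp: uniform_below_def lessThan_empty_iff)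

lemma poly_time_Sample: "poly_time (Sample x e)"
proof -
  obtain P where P: "\<And>s M. (\<forall>x. vsize (s x) \<le> M) \<longrightarrow> cost s e \<le> poly P M" using cost_poly by blast
  show ?thesis
  proof (rule poly_timeI[where P = P])
    fix s :: store and M L :: nat assume "\<forall>x. vsize (s x) \<le> M"
    then have "cost s e \<le> poly P M" using P by blast
    also have "\<dots> \<le> poly P (M + L)" by (simp add: poly_nat_mono)
    finally show "lossless_spmf (exec orc (Sample x e) (s, 0)) \<and>
       (\<forall>(s', t) \<in> set_spmf (exec orc (Sample x e) (s, 0)). t \<le> poly P (M + L))" for orc by auto
  qed
qed

lemma poly_time_Query: "poly_time (Query x e)"
proof -
  obtain P where P: "\<And>s M. (\<forall>x. vsize (s x) \<le> M) \<longrightarrow> cost s e \<le> poly P M" using cost_poly by blast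
  show ?thesis
  \<comment> \<open>The identity polynomial at \<open>M + L\<close> pays for storing an answer of
    size at most \<open>L\<close>.\<close>
  proof (rule poly_timeI[where P = "P + [:0, 1:]"])
    fix orc :: "val \<Rightarrow> val pmf" and s :: store and M L :: nat
    assume orc: "\<forall>w. \<forall>a \<in> set_pmf (orc w). vsize a \<le> L" and "\<forall>x. vsize (s x) \<le> M"
    then have "cost s e \<le> poly P M" using P by blast
    also have "\<dots> \<le> poly P (M + L)" by (simp add: poly_nat_mono)
    finally show "lossless_spmf (exec orc (Query x e) (s, 0)) \<and>
       (\<forall>(s', t) \<in> set_spmf (exec orc (Query x e) (s, 0)). t \<le> poly (P + [:0, 1:]) (M + L))"
      using orc by (fastforce intro: add_mono trans_le_add2)
  qed
qed

text \<open>A subroutine starts in a fresh store, which is the situation of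
  \<open>ppt_oracle\<close>. This is how programs given as black boxes become parts of the
  reduction.\<close>

lemma poly_time_Call:
  assumes "ppt_oracle c"
  shows "poly_time (Call x c e)"
proof -
  obtain Q where Q: "\<And>s M. (\<forall>x. vsize (s x) \<le> M) \<longrightarrow> cost s e \<le> poly Q M" using cost_poly by blast
  from assms obtain P where P: "\<And>v L orc. (\<forall>w. \<forall>a \<in> set_pmf (orc w). vsize a \<le> L) \<Longrightarrow>
     lossless_spmf (run orc c v) \<and> (\<forall>(a, t) \<in> set_spmf (run orc c v). t \<le> poly P (vsize v + L))"
    unfolding ppt_oracle_def by blast
  define P' where "P' = pcompose P (Q + [:0, 1:])"
  show ?thesis
  \<comment> \<open>\<open>Q\<close> bounds cost and size of the argument, \<open>P'\<close> the
    running time on it. Each counts twice because copying the result out costs its size, at most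
    argument size plus running time.\<close>
  proof (rule poly_timeI[where P = "2 * Q + 2 * P'"])
    fix orc :: "val \<Rightarrow> val pmf" and s :: store and M L :: nat
    assume orc: "\<forall>w. \<forall>a \<in> set_pmf (orc w). vsize a \<le> L" and s: "\<forall>x. vsize (s x) \<le> M"
    let ?v = "eval s e"
    have *: "exec orc c (init_store ?v, cost s e) =
        map_spmf (apsnd (\<lambda>u. u + cost s e)) (exec orc c (init_store ?v, 0))"
      using exec_shift[of orc c "init_store ?v" 0 "cost s e"] by simp
    have "lossless_spmf (run orc c ?v)" and B: "\<forall>(a, t) \<in> set_spmf (run orc c ?v). t \<le> poly P (vsize ?v + L)"
      using P[OF orc, of ?v] by simp_all
    then have L: "lossless_spmf (exec orc c (init_store ?v, 0))" by (simp add: run_def)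
    have C: "cost s e \<le> poly Q (M + L)"
      using Q s poly_nat_mono[of M "M + L" Q] by (meson le_add1 le_trans)
    have V: "vsize ?v \<le> poly Q (M + L)" using C vsize_eval_le_cost le_trans by blast
    then have PP: "poly P (vsize ?v + L) \<le> poly P' (M + L)"
      by (auto simp: P'_def poly_pcompose intro!: poly_nat_mono)
    have "u + cost s e + vsize (r 0) \<le> 2 * poly Q (M + L) + 2 * poly P' (M + L)"
      if r: "(r, u) \<in> set_spmf (exec orc c (init_store ?v, 0))" for r u
    proof -
      from r have "(r 0, u) \<in> set_spmf (run orc c ?v)" by (force simp: run_def)
      with B PP have u: "u \<le> poly P' (M + L)" by fastforce
      have "vsize (init_store ?v y) \<le> vsize ?v + 0" for y
        using vsize_pos[of ?v] by (simp add: init_store_def)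
      from exec_bounds[OF r this] have "vsize (r 0) \<le> vsize ?v + u" by simp
      with u C V show ?thesis by simp
    qed
    with L show "lossless_spmf (exec orc (Call x c e) (s, 0)) \<and>
       (\<forall>(s', t) \<in> set_spmf (exec orc (Call x c e) (s, 0)). t \<le> poly (2 * Q + 2 * P') (M + L))"
      by (auto simp: *)
  qed
qed

lemma poly_time_Seq:
  assumes "poly_time c" "poly_time d"
  shows "poly_time (Seq c d)"
proof -
  from assms obtain P Q where P: "time_bound c P" and Q: "time_bound d Q" by (auto simp: poly_time_def)
  show ?thesis
  \<comment> \<open>After \<open>c\<close> the registers have size at most
    \<open>M + poly P (M + L)\<close>; adding \<open>L\<close> gives the inner polynomial at
    \<open>M + L\<close>.\<close>
  proof (rule poly_timeI[where P = "P + pcompose Q (P + [:0, 1:])"])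
    fix orc :: "val \<Rightarrow> val pmf" and s :: store and M L :: nat
    assume orc: "\<forall>w. \<forall>a \<in> set_pmf (orc w). vsize a \<le> L" and s: "\<forall>x. vsize (s x) \<le> M"
    note c = time_boundD[OF P orc s]
    have "lossless_spmf (exec orc d (r, u)) \<and> (\<forall>(s', t) \<in> set_spmf (exec orc d (r, u)).
        t \<le> poly (P + pcompose Q (P + [:0, 1:])) (M + L))"
      if r: "(r, u) \<in> set_spmf (exec orc c (s, 0))" for r u
      using c(2)[OF r] time_boundD(1,2)[OF Q orc c(3)[OF r]]
      by (fastforce simp: poly_pcompose ac_simps)
    with c(1) show "lossless_spmf (exec orc (Seq c d) (s, 0)) \<and>
       (\<forall>(s', t) \<in> set_spmf (exec orc (Seq c d) (s, 0)). t \<le> poly (P + pcompose Q (P + [:0, 1:])) (M + L))"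
      by (fastforce simp: set_bind_spmf)
  qed
qed

lemma poly_time_Cond:
  assumes "poly_time c" "poly_time d"
  shows "poly_time (Cond e c d)"
proof -
  obtain R where R: "\<And>s M. (\<forall>x. vsize (s x) \<le> M) \<longrightarrow> cost s e \<le> poly R M" using cost_poly by blast
  from assms obtain P Q where P: "time_bound c P" and Q: "time_bound d Q" by (auto simp: poly_time_def)
  show ?thesis
  proof (rule poly_timeI[where P = "R + P + Q"])
    fix orc :: "val \<Rightarrow> val pmf" and s :: store and M L :: nat
    assume orc: "\<forall>w. \<forall>a \<in> set_pmf (orc w). vsize a \<le> L" and s: "\<forall>x. vsize (s x) \<le> M"
    have C: "cost s e \<le> poly R (M + L)"
      using R s poly_nat_mono[of M "M + L" R] by (meson le_add1 le_trans)
    note c = time_boundD[OF P orc s] and d = time_boundD[OF Q orc s]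
    show "lossless_spmf (exec orc (Cond e c d) (s, 0)) \<and>
       (\<forall>(s', t) \<in> set_spmf (exec orc (Cond e c d) (s, 0)). t \<le> poly (R + P + Q) (M + L))"
      using c(1) d(1) C by (auto dest!: c(2) d(2))
  qed
qed

section \<open>Final stores\<close>

definition final :: "(val \<Rightarrow> val pmf) \<Rightarrow> com \<Rightarrow> store \<Rightarrow> store spmf" where
  "final orc c s = map_spmf fst (exec orc c (s, 0))"

lemma map_fst_exec: "map_spmf fst (exec orc c (s, t)) = final orc c s"
  using exec_shift[of orc c s 0 t] by (simp add: final_def spmf.map_comp o_def)

lemma outcome_eq: "outcome orc c v = map_spmf (\<lambda>s. s 0) (final orc c (init_store v))"
  by (simp add: outcome_def run_def final_def spmf.map_comp o_def case_prod_unfold)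

lemma final_Assign: "final orc (Assign x e) s = return_spmf (s(x := eval s e))"
  by (simp add: final_def)

lemma final_Sample: "final orc (Sample x e) s =
    map_spmf (\<lambda>k. s(x := Atom k)) (uniform_below (vnum (eval s e)))"
  by (simp add: final_def spmf.map_comp o_def)

lemma final_Query: "final orc (Query x e) s = map_spmf (\<lambda>a. s(x := a)) (spmf_of_pmf (orc (eval s e)))"
  by (simp add: final_def pmf.map_comp o_def)

lemma final_Call: "final orc (Call x c e) s = map_spmf (\<lambda>a. s(x := a)) (outcome orc c (eval s e))"
proof -
  have "final orc (Call x c e) s =
    map_spmf (\<lambda>r. s(x := r 0)) (map_spmf fst (exec orc c (init_store (eval s e), cost s e)))"
    by (simp add: final_def spmf.map_comp o_def case_prod_unfold)
  then show ?thesis by (simp only: map_fst_exec outcome_eq spmf.map_comp o_def)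
qed

lemma final_Seq: "final orc (Seq c d) s = bind_spmf (final orc c s) (final orc d)"
proof -
  have *: "map_spmf fst (exec orc d st) = final orc d (fst st)" for st
    by (cases st) (simp add: map_fst_exec)
  have "final orc (Seq c d) s = bind_spmf (exec orc c (s, 0)) (\<lambda>st. final orc d (fst st))"
    by (simp add: final_def[of orc "Seq c d"] map_spmf_bind_spmf o_def *)
  also have "\<dots> = bind_spmf (final orc c s) (final orc d)"
    by (simp add: final_def[of orc c] bind_map_spmf o_def)
  finally show ?thesis .
qed

lemma final_Cond: "final orc (Cond e c d) s = (if eval s e \<noteq> Atom 0 then final orc c s else final orc d s)"
  using map_fst_exec by (simp add: final_def[of orc "Cond e c d"])

text \<open>After one unfolding the clock has advanced, but forgetting it yields the same store
  semantics from any starting clock.\<close>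

lemma final_While: "final orc (While e c) s =
   (if eval s e \<noteq> Atom 0 then bind_spmf (final orc c s) (final orc (While e c)) else return_spmf s)"
proof -
  define l where "l = loop_spmf (\<lambda>(s, t). eval s e \<noteq> Atom 0) (\<lambda>(s, t). exec orc c (s, t + cost s e))"
  have l: "map_spmf fst (l (s, t)) = final orc (While e c) s" for s t
    using map_fst_exec[of orc "While e c" s t]
    by (simp add: l_def spmf.map_comp o_def case_prod_unfold)
  have l_unfold: "l (s, 0) = (if eval s e \<noteq> Atom 0 then bind_spmf (exec orc c (s, cost s e)) l else return_spmf (s, 0))"
    unfolding l_def by (subst loop_spmf.simps) simp
  have "bind_spmf (exec orc c (s, cost s e)) (\<lambda>st. map_spmf fst (l st)) =
     bind_spmf (map_spmf fst (exec orc c (s, cost s e))) (final orc (While e c))"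
    by (auto simp: l bind_map_spmf intro!: bind_spmf_cong)
  then show ?thesis
    unfolding l[of s 0, symmetric] l_unfold by (simp add: map_spmf_bind_spmf o_def map_fst_exec)
qed

lemma outcome_query_free: "query_free c \<Longrightarrow> outcome orc c v = result c v"
  using exec_query_free[of c orc] unfolding result_def outcome_def run_def by metis

lemma lossless_result: "ppt c \<Longrightarrow> lossless_spmf (result c v)"
  unfolding ppt_def ppt_oracle_def result_def outcome_def
  \<comment> \<open>The bound 1 is the size of the dummy answer \<open>Atom 0\<close>.\<close>
  by (auto dest!: spec[of _ v] spec[of _ 1] spec[of _ "\<lambda>_. return_pmf (Atom 0)"])

section \<open>A program that samples uniform ring elements\<close>

text \<open>Register 1 is the remaining spine, 2 the modulus, 3 the fresh coefficient, 0 the output.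
  Coefficients are prepended, so the output reverses the order of drawing.\<close>

definition sample_loop :: com where
  "sample_loop = While (IsTup (Var 1))
     (Seq (Sample 3 (Var 2)) (Seq (Assign 0 (Mk (Var 3) (Var 0))) (Assign 1 (Snd (Var 1)))))"

text \<open>
  The coefficients are counted by the spine of a given list rather than by a number:
  a number in binary may be exponential in the length of a malformed input.
\<close>

definition sample_ring :: com where
  "sample_ring = Seq (Assign 1 (Snd (Var 0))) (Seq (Assign 2 (Fst (Var 0)))
     (Seq (Assign 0 (Lit (Atom 0))) sample_loop))"

text \<open>Induction on the tree in register 1, whose spine is consumed round by round. The output
  grows by at most \<open>M + 1\<close> per round, so the potential
  \<open>vsize (s 0) + vsize w * (M + 1)\<close> never exceeds its initial bound
  \<open>K\<close>.\<close>

lemma poly_time_sample_loop: "poly_time sample_loop"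
proof -
  define P where "P = [:0, 20, 20, 20 :: nat:]"
  let ?c = "Seq (Sample 3 (Var 2)) (Seq (Assign 0 (Mk (Var 3) (Var 0))) (Assign 1 (Snd (Var 1))))"
  define b where "b orc = (\<lambda>(s, t). exec orc ?c (s, t + cost s (IsTup (Var 1))))" for orc
  define l where "l orc = loop_spmf (\<lambda>(s, t). eval s (IsTup (Var 1)) \<noteq> Atom 0) (b orc)" for orc
  have l_unfold: "l orc (s, t) = (if is_tup (s 1) then bind_spmf (b orc (s, t)) (l orc) else return_spmf (s, t))" for orc s t
    unfolding l_def by (subst loop_spmf.simps) simp
  \<comment> \<open>\<open>7 * M + 3 * K\<close> is a generous price for one round. The final size
    of register 1 is tracked to pay for the last, failing test of the guard.\<close>
  have loop: "lossless_spmf (l orc (s, t)) \<and>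
     (\<forall>(s', t') \<in> set_spmf (l orc (s, t)). t' \<le> t + vsize w * (7 * M + 3 * K) \<and> vsize (s' 1) \<le> M)"
    if "s 1 = w" "vsize (s 2) \<le> M" "vsize w \<le> M" "vsize (s 0) + vsize w * (M + 1) \<le> K" for orc s t w M K
    using that
  proof (induction w arbitrary: s t)
    case (Atom n)
    then show ?case by (simp add: l_unfold)
  next
    case (Tup v w)
    let ?s = "\<lambda>k. s(3 := Atom k, 0 := Tup (Atom k) (s 0), 1 := w)"
    let ?t = "\<lambda>k. t + cost s (IsTup (Var 1)) + vsize (s 2) + (2 * vsize (Atom k) + 2 * vsize (s 0) + 1) + (vsize (Tup v w) + vsize w)"
    let ?u = "uniform_below (vnum (s 2))"
    have [simp]: "s (Suc 0) = Tup v w" using Tup.prems(1) by simp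
    have "b orc (s, t) = map_spmf (\<lambda>k. (?s k, ?t k)) ?u"
      by (auto simp: b_def map_spmf_conv_bind_spmf intro!: bind_spmf_cong)
    then have eq: "l orc (s, t) = bind_spmf ?u (\<lambda>k. l orc (?s k, ?t k))"
      by (subst l_unfold) (simp add: bind_map_spmf o_def)
    have k: "vsize (Atom k) \<le> M" if "k \<in> set_spmf ?u" for k
    proof (cases "vnum (s 2) = 0")
      case True
      with that show ?thesis using vsize_pos[of w] Tup.prems by (auto simp: uniform_below_def)
    next
      case False
      with that have "k \<le> vnum (s 2)" by (auto simp: uniform_below_def)
      then show ?thesis using Tup.prems(2) vsize_Atom_le_vnum le_trans by blast
    qed
    have "vsize v \<ge> 1" using vsize_pos[of v] by simp
    \<comment> \<open>Removing one cell shrinks the spine by at least 2, which releases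
      \<open>2 * (M + 1)\<close> of potential, more than the output gains.\<close>
    then have "(vsize w + 2) * (M + 1) \<le> vsize (Tup v w) * (M + 1)" by (intro mult_right_mono) auto
    then have K: "vsize (s 0) + vsize w * (M + 1) + 2 * M + 2 \<le> K"
      using Tup.prems(4) by (simp add: algebra_simps)
    have t: "?t k \<le> t + (7 * M + 3 * K)" if "k \<in> set_spmf ?u" for k
      using k[OF that] K Tup.prems by simp
    have IH: "lossless_spmf (l orc (?s k, ?t k)) \<and>
     (\<forall>(s', t') \<in> set_spmf (l orc (?s k, ?t k)). t' \<le> ?t k + vsize w * (7 * M + 3 * K) \<and> vsize (s' 1) \<le> M)"
      if "k \<in> set_spmf ?u" for k
      by (rule Tup.IH(2)) (use k[OF that] K Tup.prems in auto)
    have "1 * (7 * M + 3 * K) + vsize w * (7 * M + 3 * K) \<le> vsize (Tup v w) * (7 * M + 3 * K)"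
      unfolding add_mult_distrib[symmetric] by (intro mult_right_mono) auto
    then have sum: "t + (7 * M + 3 * K) + vsize w * (7 * M + 3 * K) \<le> t + vsize (Tup v w) * (7 * M + 3 * K)"
      by (simp del: vsize.simps)
    show ?case
      unfolding eq
    proof (intro conjI ballI)
      show "lossless_spmf (bind_spmf ?u (\<lambda>k. l orc (?s k, ?t k)))"
        using IH by simp
    next
      fix st assume "st \<in> set_spmf (bind_spmf ?u (\<lambda>k. l orc (?s k, ?t k)))"
      then obtain k where k: "k \<in> set_spmf ?u" and st: "st \<in> set_spmf (l orc (?s k, ?t k))"
        by (auto simp: set_bind_spmf)
      obtain s' t' where [simp]: "st = (s', t')" by force
      from IH[OF k] st have "t' \<le> ?t k + vsize w * (7 * M + 3 * K)" "vsize (s' 1) \<le> M" by auto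
      with t[OF k] sum show "case st of (s', t') \<Rightarrow> t' \<le> t + vsize (Tup v w) * (7 * M + 3 * K) \<and> vsize (s' 1) \<le> M"
        by (simp del: vsize.simps)
    qed
  qed
  show ?thesis
  proof (rule poly_timeI[where P = P])
    fix orc :: "val \<Rightarrow> val pmf" and s :: store and M L :: nat
    assume s: "\<forall>x. vsize (s x) \<le> M"
    define K where "K = M + M * (M + 1)"
    have "vsize (s 1) * (M + 1) \<le> M * (M + 1)" using s by (intro mult_right_mono) auto
    then have K: "vsize (s 0) + vsize (s 1) * (M + 1) \<le> K" using s by (simp add: K_def add_mono)
    have "1 \<le> M" using s vsize_pos[of "s 0"] by (metis One_nat_def Suc_le_eq less_le_trans)
    then have M: "M \<le> M * M" "M * M \<le> M * M * M" "M \<le> M * M * M" by auto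
    have bound: "vsize (s 1) * (7 * M + 3 * K) + M + 1 \<le> poly P (M + L)"
    proof -
      have "vsize (s 1) * (7 * M + 3 * K) + M + 1 \<le> M * (7 * M + 3 * K) + M + 1"
        using s by simp
      also have "\<dots> \<le> poly P M"
        using M \<open>1 \<le> M\<close> by (simp add: P_def K_def algebra_simps)
      also have "\<dots> \<le> poly P (M + L)" by (simp add: poly_nat_mono)
      finally show ?thesis .
    qed
    show "lossless_spmf (exec orc sample_loop (s, 0)) \<and>
       (\<forall>(s', t) \<in> set_spmf (exec orc sample_loop (s, 0)). t \<le> poly P (M + L))"
      using loop[of s "s 1" M K orc 0] s K bound unfolding sample_loop_def l_def b_def
      by (fastforce simp del: vsize.simps simp add: vsize_bool)
  qed
qed

lemma poly_time_sample_ring: "poly_time sample_ring"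
  unfolding sample_ring_def
  by (intro poly_time_Seq poly_time_Assign poly_time_sample_loop)

lemma final_sample_loop:
  assumes "s 1 = enc_list vs" "s 2 = Atom q" "0 < q"
  shows "map_spmf (\<lambda>s. s 0) (final orc sample_loop s) =
     spmf_of_pmf (map_pmf (\<lambda>xs. fold (\<lambda>x. Tup (Atom x)) xs (s 0)) (replicate_pmf (length vs) (pmf_of_set {..<q})))"
  using assms
proof (induction vs arbitrary: s)
  case Nil
  then show ?case unfolding sample_loop_def by (subst final_While) (simp add: enc_list_def)
next
  case (Cons v vs)
  have u: "uniform_below q = spmf_of_pmf (pmf_of_set {..<q})"
    using \<open>0 < q\<close> by (auto simp: uniform_below_def lessThan_empty_iff)
  have "final orc sample_loop s = bind_spmf (uniform_below q)
     (\<lambda>k. final orc sample_loop (s(3 := Atom k, 0 := Tup (Atom k) (s 0), 1 := enc_list vs)))"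
    using Cons.prems unfolding sample_loop_def
    by (subst final_While)
      (simp add: final_Seq final_Sample final_Assign enc_list_def map_spmf_conv_bind_spmf)
  then have "final orc sample_loop s = bind_pmf (pmf_of_set {..<q})
     (\<lambda>k. final orc sample_loop (s(3 := Atom k, 0 := Tup (Atom k) (s 0), 1 := enc_list vs)))"
    unfolding u bind_spmf_of_pmf .
  moreover have "map_spmf (\<lambda>s. s 0) (final orc sample_loop (s(3 := Atom k, 0 := Tup (Atom k) (s 0), 1 := enc_list vs))) =
     spmf_of_pmf (map_pmf (\<lambda>xs. fold (\<lambda>x. Tup (Atom x)) xs (Tup (Atom k) (s 0))) (replicate_pmf (length vs) (pmf_of_set {..<q})))" for k
    by (subst Cons.IH) (use Cons.prems in auto)
  ultimately show ?case
    by (simp add: map_bind_pmf map_pmf_def[symmetric] o_def spmf_of_pmf_bind pmf.map_comp)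
qed

section \<open>Uniform ring elements\<close>

lemma pair_pmf_of_set:
  assumes "finite A" "A \<noteq> {}" "finite B" "B \<noteq> {}"
  shows "pair_pmf (pmf_of_set A) (pmf_of_set B) = pmf_of_set (A \<times> B)"
proof (rule pmf_eqI)
  fix z
  show "pmf (pair_pmf (pmf_of_set A) (pmf_of_set B)) z = pmf (pmf_of_set (A \<times> B)) z"
    by (cases z) (simp add: assms pmf_pair indicator_def card_cartesian_product)
qed

lemma replicate_pmf_of_set:
  assumes "finite A" "A \<noteq> {}"
  shows "replicate_pmf n (pmf_of_set A) = pmf_of_set {xs. set xs \<subseteq> A \<and> length xs = n}"
proof (induction n)
  case 0
  have "{xs. set xs \<subseteq> A \<and> length xs = 0} = {[]}" by auto
  then show ?case by (simp add: pmf_of_set_singleton)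
next
  case (Suc n)
  let ?B = "\<lambda>n. {xs. set xs \<subseteq> A \<and> length xs = n}"
  have B: "finite (?B n)" "?B n \<noteq> {}"
  proof -
    obtain a where "a \<in> A" using assms(2) by blast
    then have "replicate n a \<in> ?B n" by auto
    then show "?B n \<noteq> {}" by blast
  qed (use assms finite_lists_length_eq in auto)
  have "replicate_pmf (Suc n) (pmf_of_set A) =
      map_pmf (\<lambda>(x, xs). x # xs) (pair_pmf (pmf_of_set A) (replicate_pmf n (pmf_of_set A)))"
    by (simp add: pair_pmf_def map_pmf_def bind_return_pmf bind_assoc_pmf)
  also have "\<dots> = map_pmf (\<lambda>(x, xs). x # xs) (pmf_of_set (A \<times> ?B n))"
    using assms B by (simp add: Suc pair_pmf_of_set)
  also have "\<dots> = pmf_of_set ((\<lambda>(x, xs). x # xs) ` (A \<times> ?B n))"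
    using assms B by (intro map_pmf_of_set_inj) (auto simp: inj_on_def)
  also have "(\<lambda>(x, xs). x # xs) ` (A \<times> ?B n) = ?B (Suc n)"
    by (auto simp: length_Suc_conv image_iff)
  finally show ?case .
qed

text \<open>Polynomials are matched with lists of draws in drawing order; \<open>rev\<close> appears
  because the first draw becomes the top coefficient.\<close>

lemma bij_betw_ring_mod:
  assumes "0 < N" "0 < k"
  shows "bij_betw (\<lambda>f. rev (map (\<lambda>i. nat (coeff f i)) [0..<N])) (ring_mod N k)
     {xs. set xs \<subseteq> {..<k} \<and> length xs = N}"
proof (rule bij_betw_byWitness[where f' = "\<lambda>xs. Poly (map int (rev xs))"], goal_cases)
  case 1
  show ?case
  proof
    fix f assume f: "f \<in> ring_mod N k"
    then have "coeff f i = 0" if "\<not> i < N" for i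
      using that by (auto simp: ring_mod_def intro: coeff_eq_0)
    with f show "Poly (map int (rev (rev (map (\<lambda>i. nat (coeff f i)) [0..<N])))) = f"
      by (intro poly_eqI) (auto simp: nth_default_def ring_mod_def)
  qed
next
  case 2
  show ?case
  proof
    fix xs assume "xs \<in> {xs. set xs \<subseteq> {..<k} \<and> length xs = N}"
    then have N: "length (rev xs) = N" by simp
    have "map (\<lambda>i. nat (coeff (Poly (map int (rev xs))) i)) [0..<N] = rev xs"
      by (rule nth_equalityI) (use N in \<open>auto simp: nth_default_def\<close>)
    then show "rev (map (\<lambda>i. nat (coeff (Poly (map int (rev xs))) i)) [0..<N]) = xs" by simp
  qed
next
  case 3
  show ?case by (auto simp: ring_mod_def nat_less_iff)
next
  case 4
  show ?case
  proof
    fix f assume "f \<in> (\<lambda>xs. Poly (map int (rev xs))) ` {xs. set xs \<subseteq> {..<k} \<and> length xs = N}"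
    then obtain xs where xs: "set xs \<subseteq> {..<k}" "length xs = N" and f: "f = Poly (map int (rev xs))" by blast
    have "coeff f i \<in> {0..<int k}" for i
    proof (cases "i < N")
      case True
      then have "rev xs ! i \<in> set xs" using xs(2) by (metis length_rev nth_mem set_rev)
      with xs have "rev xs ! i < k" by auto
      then show ?thesis using xs(2) True by (simp add: f nth_default_def)
    qed (use xs assms in \<open>simp add: f nth_default_def\<close>)
    moreover have "degree f < N"
      by (rule le_less_trans[of _ "N - 1"], rule degree_le) (use xs assms in \<open>auto simp: f nth_default_def\<close>)
    ultimately show "f \<in> ring_mod N k" by (simp add: ring_mod_def)
  qed
qed

lemma finite_ring_mod:
  assumes "0 < N" "0 < k"
  shows "finite (ring_mod N k)" and "ring_mod N k \<noteq> {}"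
proof -
  have "finite {xs. set xs \<subseteq> {..<k} \<and> length xs = N}" by (simp add: finite_lists_length_eq)
  then show "finite (ring_mod N k)" using bij_betw_finite[OF bij_betw_ring_mod[OF assms]] by simp
  have "0 \<in> ring_mod N k" using assms by (simp add: ring_mod_def)
  then show "ring_mod N k \<noteq> {}" by blast
qed

text \<open>The template \<open>f\<close> only lends the length \<open>N\<close> of its list. The
  reduction uses the first component of the public key for it.\<close>

lemma outcome_sample_ring:
  assumes "0 < N" "0 < q"
  shows "outcome orc sample_ring (Tup (Atom q) (enc_ring N f)) =
    spmf_of_pmf (map_pmf (enc_ring N) (pmf_of_set (ring_mod N q)))"
proof -
  let ?g = "\<lambda>f. rev (map (\<lambda>i. nat (coeff f i)) [0..<N])"
  let ?s = "(init_store (Tup (Atom q) (enc_ring N f)))(1 := enc_ring N f, 2 := Atom q, 0 := Atom 0)"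
  have "outcome orc sample_ring (Tup (Atom q) (enc_ring N f)) =
     map_spmf (\<lambda>s. s 0) (final orc sample_loop ?s)"
    by (simp add: outcome_eq sample_ring_def final_Seq final_Assign init_store_def)
  also have "\<dots> = spmf_of_pmf (map_pmf (\<lambda>xs. fold (\<lambda>x. Tup (Atom x)) xs (?s 0)) (replicate_pmf N (pmf_of_set {..<q})))"
    using assms
    by (subst final_sample_loop[where vs = "map (\<lambda>i. Atom (nat (coeff f i))) [0..<N]" and q = q])
      (auto simp: enc_ring_def)
  also have "replicate_pmf N (pmf_of_set {..<q}) = pmf_of_set {xs. set xs \<subseteq> {..<q} \<and> length xs = N}"
    using assms by (intro replicate_pmf_of_set) (auto simp: lessThan_empty_iff)
  also have "\<dots> = map_pmf ?g (pmf_of_set (ring_mod N q))"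
    by (rule map_pmf_of_set_bij_betw[symmetric, OF bij_betw_ring_mod[OF assms] finite_ring_mod(2,1)[OF assms]])
  also have "map_pmf (\<lambda>xs. fold (\<lambda>x. Tup (Atom x)) xs (?s 0)) \<dots> = map_pmf (enc_ring N) (pmf_of_set (ring_mod N q))"
    by (auto simp: pmf.map_comp enc_ring_def enc_list_def foldr_conv_fold rev_map fold_map o_def intro!: map_pmf_cong)
  finally show ?thesis .
qed

section \<open>Additive masking in \<open>Rq\<close>\<close>

text \<open>Once \<open>h\<close> is reduced as well, a polynomial of degree below \<open>N\<close>
  is a multiple of the monic \<open>cyclo N\<close>, hence zero. So the coefficients agree modulo
  \<open>k\<close>, and they lie in \<open>{0..<k}\<close>.\<close>

lemma ring_mod_unique:
  assumes "0 < N" "0 < k" "f \<in> ring_mod N k" "f' \<in> ring_mod N k"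
    and eq: "f - f' = cyclo N * g + smult (int k) h"
  shows "f = f'"
proof -
  obtain d where "h - redR N h = cyclo N * d" using redR_cong(1)[OF assms(1), of h] by (auto elim: dvdE)
  then have h: "h = cyclo N * d + redR N h" by simp
  let ?r = "f - f' - smult (int k) (redR N h)"
  have "?r = cyclo N * (g + smult (int k) d)"
    by (subst eq, subst h) (simp add: algebra_simps smult_add_right)
  moreover have "degree ?r < N"
    using assms(3,4) redR_cong(2)[OF assms(1), of h] unfolding ring_mod_def
    by (intro degree_diff_less le_less_trans[OF degree_smult_le]) auto
  ultimately have "?r = 0"
    using degree_cyclo[OF assms(1)] by (metis dvd_imp_degree_le dvd_triv_left linorder_not_le)
  then have d: "f - f' = smult (int k) (redR N h)" by simp
  show ?thesis
  proof (rule poly_eqI)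
    fix i
    have "int k dvd coeff f i - coeff f' i" using arg_cong[OF d, of "\<lambda>p. coeff p i"] by simp
    then have "coeff f i mod int k = coeff f' i mod int k" by (simp add: mod_eq_dvd_iff)
    then show "coeff f i = coeff f' i" using assms(3,4) by (simp add: ring_mod_def)
  qed
qed

lemma red_diff_involutory:
  assumes "0 < N" "0 < k" "g \<in> ring_mod N k"
  shows "red N k (f - red N k (f - g)) = g"
proof -
  obtain a b where 1: "f - g - red N k (f - g) = cyclo N * a + smult (int k) b"
    using red_cong[OF assms(1)] by blast
  obtain c d where 2: "f - red N k (f - g) - red N k (f - red N k (f - g)) = cyclo N * c + smult (int k) d"
    using red_cong[OF assms(1)] by blast
  have "red N k (f - red N k (f - g)) - g = cyclo N * (a - c) + smult (int k) (b - d)"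
    unfolding right_diff_distrib smult_diff_right using 1 2 by (simp add: algebra_simps)
  then show ?thesis using ring_mod_unique[OF assms(1,2) red_in_ring_mod[OF assms(1,2)] assms(3)] by blast
qed

text \<open>One-time pad: subtraction from a fixed \<open>u\<close> is its own inverse on reduced
  pairs. \<open>u\<close> itself may be unreduced, as secrets have coefficients -1.\<close>

lemma map_sub_pair_uniform:
  assumes "0 < dim par" "0 < ctmod par"
  shows "map_pmf (sub_pair par u) (pmf_of_set (Rq par \<times> Rq par)) = pmf_of_set (Rq par \<times> Rq par)"
proof (rule map_pmf_of_set_bij_betw)
  show "bij_betw (sub_pair par u) (Rq par \<times> Rq par) (Rq par \<times> Rq par)"
    by (rule bij_betw_byWitness[where f' = "sub_pair par u"])
      (use assms in \<open>auto simp: sub_pair_def red_diff_involutory red_in_ring_mod split: prod.splits\<close>)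
qed (use finite_ring_mod[OF assms] in auto)

section \<open>The reduction\<close>

text \<open>Registers: 0 input, 1 modulus \<open>q\<close>, 2 output of \<open>A1\<close>, 3
  challenge bit, 4 challenge message, 5 and 6 ciphertexts, 7 and 8 keys, 9 to 12 the simulated
  share, 13 output of \<open>A2\<close>. Comparison with \<open>Atom 0\<close> in the last line is
  negation.\<close>

definition kdm_adversary :: "com \<Rightarrow> com \<Rightarrow> com \<Rightarrow> com \<Rightarrow> com" where
  "kdm_adversary cp ck A1 A2 =
     Seq (Call 1 cp (Fst (Var 0)))
    (Seq (Assign 1 (Fst (Snd (Snd (Var 1)))))
    (Seq (Call 2 A1 (Fst (Var 0)))
    (Seq (Sample 3 (Lit (Atom 2)))
    (Seq (Cond (Var 3) (Assign 4 (Fst (Snd (Snd (Var 2))))) (Assign 4 (Fst (Snd (Var 2)))))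
    (Seq (Call 9 sample_ring (Mk (Var 1) (Fst (Snd (Var 0)))))
    (Seq (Call 10 sample_ring (Mk (Var 1) (Fst (Snd (Var 0)))))
    (Seq (Call 11 sample_ring (Mk (Var 1) (Fst (Snd (Var 0)))))
    (Seq (Call 12 sample_ring (Mk (Var 1) (Fst (Snd (Var 0)))))
    (Seq (Call 7 ck (Fst (Var 0)))
    (Seq (Call 8 ck (Fst (Var 0)))
    (Seq (Query 5 (Mk (Var 4) (Lit (Atom 1))))
    (Seq (Query 6 (Mk (Var 4) (Lit (Atom 2))))
    (Seq (Call 13 A2 (Mk (Snd (Snd (Snd (Var 2)))) (Mk (Snd (Var 0))
       (Mk (Mk (Var 7) (Mk (Var 8) (Mk (Mk (Var 9) (Var 10)) (Mk (Var 11) (Var 12))))) (Mk (Var 5) (Var 6))))))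
    (Assign 0 (Eq (Lit (Atom 0)) (Eq (Eq (Var 13) (Lit (Atom 1))) (Var 3)))))))))))))))))"

lemma ppt_oracle_kdm_adversary:
  assumes "ppt cp" "ppt ck" "ppt A1" "ppt A2"
  shows "ppt_oracle (kdm_adversary cp ck A1 A2)"
  unfolding kdm_adversary_def
  by (rule poly_time_imp_ppt_oracle, intro poly_time_Seq poly_time_Assign poly_time_Call poly_time_Sample
      poly_time_Query poly_time_Cond poly_time_imp_ppt_oracle[OF poly_time_sample_ring])
    (use assms in \<open>auto simp: ppt_def\<close>)

text \<open>The draws follow the order of the program, coordinate by coordinate, so that symbolic
  execution ends in this very term. The oracle is a parameter to serve both worlds.\<close>

definition view :: "params \<Rightarrow> val set \<Rightarrow> com \<Rightarrow> int poly \<times> int poly \<Rightarrow> (val \<Rightarrow> val pmf) \<Rightarrow> val \<Rightarrow> val \<Rightarrow> val spmf" where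
  "view par Keys A2 pk orc st x = do {
     s0 \<leftarrow> spmf_of_set (Rq par);
     s1 \<leftarrow> spmf_of_set (Rq par);
     t0 \<leftarrow> spmf_of_set (Rq par);
     t1 \<leftarrow> spmf_of_set (Rq par);
     K1 \<leftarrow> spmf_of_set Keys;
     K2 \<leftarrow> spmf_of_set Keys;
     c \<leftarrow> spmf_of_pmf (orc (Tup x (Atom 1)));
     d \<leftarrow> spmf_of_pmf (orc (Tup x (Atom 2)));
     result A2 (Tup st (Tup (enc_pair (dim par) pk)
       (Tup (enc_ek par (K1, K2, (s0, s1), (t0, t1))) (Tup c d))))
   }"

definition game :: "(nat \<Rightarrow> params) \<Rightarrow> (nat \<Rightarrow> val set) \<Rightarrow> com \<Rightarrow> com \<Rightarrow> nat \<Rightarrow> int poly \<times> int poly \<Rightarrow> bool \<Rightarrow> bool spmf" where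
  "game par KS A1 A2 \<kappa> pk \<delta> = do {
     u \<leftarrow> result A1 (unary \<kappa>);
     \<beta> \<leftarrow> coin_spmf;
     v \<leftarrow> view (par \<kappa>) (KS \<kappa>) A2 pk (kdm_oracle (par \<kappa>) pk \<delta>) (vsnd (vsnd (vsnd u)))
            (if \<beta> then vfst (vsnd (vsnd u)) else vfst (vsnd u));
     return_spmf (guess v = \<beta>)
   }"

lemma uniform_below_2: "uniform_below 2 = map_spmf of_bool coin_spmf"
proof -
  have "map_spmf of_bool coin_spmf = spmf_of_set (range (of_bool :: bool \<Rightarrow> nat))"
    by (rule map_spmf_of_set_inj_on) (auto simp: inj_on_def)
  also have "range (of_bool :: bool \<Rightarrow> nat) = {..<2}" by (auto simp: image_iff less_2_cases_iff)
  finally show ?thesis by (simp add: uniform_below_def)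
qed

lemma outcome_kdm_adversary:
  assumes ppt: "ppt cp" "ppt ck" "ppt A1" "ppt A2"
    and cp: "result cp (unary \<kappa>) = return_spmf (enc_list (map Atom
       [dim (par \<kappa>), ptmod (par \<kappa>), ctmod (par \<kappa>), iomod (par \<kappa>), weight (par \<kappa>)]))"
    and ck: "result ck (unary \<kappa>) = spmf_of_set (KS \<kappa>)"
    and pos: "0 < dim (par \<kappa>)" "0 < ctmod (par \<kappa>)"
  shows "outcome (kdm_oracle (par \<kappa>) pk \<delta>) (kdm_adversary cp ck A1 A2)
      (Tup (unary \<kappa>) (enc_pair (dim (par \<kappa>)) pk)) =
    map_spmf (\<lambda>w. Atom (of_bool (\<not> w))) (game par KS A1 A2 \<kappa> pk \<delta>)"
proof -
  obtain a b where pk: "pk = (a, b)" by force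
  have res: "outcome orc c v = result c v" if "ppt c" for orc c v
    using that outcome_query_free by (simp add: ppt_def)
  have ring: "outcome orc sample_ring (Tup (Atom (ctmod (par \<kappa>))) (enc_ring (dim (par \<kappa>)) a)) =
     map_spmf (enc_ring (dim (par \<kappa>))) (spmf_of_set (Rq (par \<kappa>)))" for orc
    using outcome_sample_ring[OF pos] finite_ring_mod[OF pos]
    by (simp add: map_spmf_of_pmf[symmetric] del: map_spmf_of_pmf)
  \<comment> \<open>Moving the case distinction into the stored value avoids two copies of the
    remaining run and matches the shape of \<open>game\<close>.\<close>
  have cond: "final orc (Cond (Var 3) (Assign 4 e) (Assign 4 e')) s =
     return_spmf (s(4 := if s 3 \<noteq> Atom 0 then eval s e else eval s e'))" for orc e e' s
    by (simp add: final_Cond final_Assign)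
  show ?thesis
    unfolding game_def view_def pk
    by (subst outcome_eq)
      (simp add: kdm_adversary_def final_Seq final_Call final_Assign final_Query final_Sample cond
        init_store_def res[OF ppt(1)] res[OF ppt(2)] res[OF ppt(3)] res[OF ppt(4)] cp ck
        enc_list_def enc_pair_def enc_ek_def ring uniform_below_2 bind_map_spmf map_spmf_bind_spmf o_def
        guess_def map_spmf_conv_bind_spmf of_bool_eq_iff del: map_spmf_of_pmf bind_spmf_of_pmf cong: if_cong)
qed

section \<open>Comparison of the experiments\<close>

text \<open>The first share consists of the masks themselves. The second is uniform for each fixed
  pair of secret and verification key, so their correlation with \<open>pk\<close> does no
  harm.\<close>

lemma hss_gen_marginal:
  assumes "0 < dim par" "0 < ctmod par"
  shows "map_pmf (\<lambda>(pk, vk, (ek1, ek2)). (pk, if b then ek1 else ek2)) (hss_gen par Keys) = do {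
     pk \<leftarrow> map_pmf fst (pke_gen par);
     s \<leftarrow> pmf_of_set (Rq par \<times> Rq par);
     t \<leftarrow> pmf_of_set (Rq par \<times> Rq par);
     K1 \<leftarrow> pmf_of_set Keys;
     K2 \<leftarrow> pmf_of_set Keys;
     return_pmf (pk, (K1, K2, s, t))
   }"
proof (cases b)
  case True
  then show ?thesis
    by (simp add: hss_gen_def Let_def map_bind_pmf bind_map_pmf case_prod_unfold bind_return_pmf map_pmf_def bind_assoc_pmf)
next
  case False
  let ?U = "pmf_of_set (Rq par \<times> Rq par)"
  let ?g = "\<lambda>pk s t. do {
     K1 \<leftarrow> pmf_of_set Keys;
     K2 \<leftarrow> pmf_of_set Keys;
     return_pmf (pk, (K1, K2, s, t))
   }"
  have U: "bind_pmf ?U (\<lambda>s. bind_pmf ?U (\<lambda>t. h (sub_pair par u s) (sub_pair par w t))) =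
      bind_pmf ?U (\<lambda>s. bind_pmf ?U (h s))" for u w and h :: "_ \<Rightarrow> _ \<Rightarrow> ((int poly \<times> int poly) \<times> ek) pmf"
    by (subst (3 4) map_sub_pair_uniform[OF assms, symmetric]) (simp only: bind_map_pmf)
  have "map_pmf (\<lambda>(pk, vk, (ek1, ek2)). (pk, if b then ek1 else ek2)) (hss_gen par Keys) = do {
     (pk, sk) \<leftarrow> pke_gen par;
     s' \<leftarrow> D_sk par;
     s \<leftarrow> ?U;
     t \<leftarrow> ?U;
     K1 \<leftarrow> pmf_of_set Keys;
     K2 \<leftarrow> pmf_of_set Keys;
     return_pmf (pk, (K1, K2, sub_pair par sk s, sub_pair par (redR (dim par) (s' * fst sk), redR (dim par) (s' * snd sk)) t))
   }"
    using False by (simp add: hss_gen_def Let_def map_bind_pmf case_prod_unfold)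
  also have "\<dots> = do {
     (pk, sk) \<leftarrow> pke_gen par;
     s' \<leftarrow> D_sk par;
     s \<leftarrow> ?U;
     t \<leftarrow> ?U;
     K1 \<leftarrow> pmf_of_set Keys;
     K2 \<leftarrow> pmf_of_set Keys;
     return_pmf (pk, (K1, K2, s, t))
   }"
    by (simp only: U[of "?g _"])
  \<comment> \<open>The secret key and \<open>s'\<close> no longer occur; their draws vanish as they
    have total mass 1.\<close>
  also have "\<dots> = do {
     pk \<leftarrow> map_pmf fst (pke_gen par);
     s \<leftarrow> ?U;
     t \<leftarrow> ?U;
     K1 \<leftarrow> pmf_of_set Keys;
     K2 \<leftarrow> pmf_of_set Keys;
     return_pmf (pk, (K1, K2, s, t))
   }"
    by (simp add: bind_map_pmf case_prod_unfold)
  finally show ?thesis .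
qed

lemma bind_spmf_bind_pmf: "bind_spmf (bind_pmf p f) g = bind_pmf p (\<lambda>x. bind_spmf (f x) g)"
  by (simp add: bind_spmf_def bind_assoc_pmf)

text \<open>The real oracle reduces its query modulo \<open>p\<close> just as \<open>hss_enc\<close>
  does, so forwarding the encoded message gives the right ciphertexts. The public key is independent
  of the first stage and can be drawn up front, as in the KDM experiment.\<close>

lemma ss_exp_eq:
  assumes "0 < dim (par \<kappa>)" "0 < ctmod (par \<kappa>)" "finite (KS \<kappa>)" "KS \<kappa> \<noteq> {}"
  shows "ss_exp par KS A1 A2 \<kappa> =
    bind_spmf (spmf_of_pmf (map_pmf fst (pke_gen (par \<kappa>)))) (\<lambda>pk. game par KS A1 A2 \<kappa> pk False)"
proof -
  let ?p = "par \<kappa>"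
  let ?gen = "spmf_of_pmf (map_pmf fst (pke_gen ?p))"
  let ?R = "pmf_of_set (Rq ?p)"
  have keys: "spmf_of_set (KS \<kappa>) = spmf_of_pmf (pmf_of_set (KS \<kappa>))"
    using assms by simp
  have ring: "spmf_of_set (Rq ?p) = spmf_of_pmf ?R"
    using finite_ring_mod[OF assms(1,2)] by simp
  have ring2: "pmf_of_set (Rq ?p \<times> Rq ?p) = pair_pmf ?R ?R"
    using finite_ring_mod[OF assms(1,2)] by (simp add: pair_pmf_of_set)
  have queries: "kdm_oracle ?p pk False (Tup x (Atom 1)) = map_pmf (enc_pair (dim ?p)) (pke_okdm ?p pk (modp ?p (dec_ring x)) 1)"
    "kdm_oracle ?p pk False (Tup x (Atom 2)) = map_pmf (enc_pair (dim ?p)) (pke_okdm ?p pk (modp ?p (dec_ring x)) 2)" for pk x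
    by (simp_all add: kdm_oracle_def)
  have stage2: "bind_spmf (spmf_of_pmf (hss_gen ?p (KS \<kappa>))) (\<lambda>(pk, vk, (ek1, ek2)).
      bind_spmf (spmf_of_pmf (hss_enc ?p pk (dec_ring x))) (\<lambda>ct.
      bind_spmf (result A2 (Tup st (Tup (enc_pair (dim ?p) pk)
            (Tup (enc_ek ?p (if b then ek1 else ek2)) (enc_cts ?p ct))))) f)) =
    bind_spmf ?gen (\<lambda>pk. bind_spmf (view ?p (KS \<kappa>) A2 pk (kdm_oracle ?p pk False) st x) f)"
    (is "?lhs = ?rhs") for x st b and f :: "val \<Rightarrow> bool spmf"
  proof -
    let ?h = "\<lambda>(pk, ek). bind_spmf (spmf_of_pmf (hss_enc ?p pk (dec_ring x))) (\<lambda>ct.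
      bind_spmf (result A2 (Tup st (Tup (enc_pair (dim ?p) pk)
            (Tup (enc_ek ?p ek) (enc_cts ?p ct))))) f)"
    have "?lhs = bind_pmf (map_pmf (\<lambda>(pk, vk, (ek1, ek2)). (pk, if b then ek1 else ek2)) (hss_gen ?p (KS \<kappa>))) ?h"
      by (simp add: bind_map_pmf case_prod_unfold)
    also have "\<dots> = bind_pmf (map_pmf fst (pke_gen ?p)) (\<lambda>pk. bind_pmf ?R (\<lambda>s0. bind_pmf ?R (\<lambda>s1.
       bind_pmf ?R (\<lambda>t0. bind_pmf ?R (\<lambda>t1. bind_pmf (pmf_of_set (KS \<kappa>)) (\<lambda>K1. bind_pmf (pmf_of_set (KS \<kappa>)) (\<lambda>K2.
       bind_pmf (pke_okdm ?p pk (modp ?p (dec_ring x)) 1) (\<lambda>c. bind_pmf (pke_okdm ?p pk (modp ?p (dec_ring x)) 2) (\<lambda>d.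
       bind_spmf (result A2 (Tup st (Tup (enc_pair (dim ?p) pk)
            (Tup (enc_ek ?p (K1, K2, (s0, s1), (t0, t1))) (enc_cts ?p (c, d)))))) f)))))))))"
      unfolding hss_gen_marginal[OF assms(1,2)]
      by (simp add: ring2 pair_pmf_def bind_assoc_pmf bind_return_pmf hss_enc_def pke_OKDM_def)
    also have "\<dots> = ?rhs"
      unfolding view_def queries keys ring
      by (simp add: bind_map_pmf bind_spmf_bind_pmf enc_cts_def del: spmf_of_pmf_pmf_of_set)
    finally show ?thesis .
  qed
  have "ss_exp par KS A1 A2 \<kappa> = do {
     u \<leftarrow> result A1 (unary \<kappa>);
     \<beta> \<leftarrow> coin_spmf;
     pk \<leftarrow> ?gen;
     v \<leftarrow> view ?p (KS \<kappa>) A2 pk (kdm_oracle ?p pk False) (vsnd (vsnd (vsnd u)))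
            (if \<beta> then vfst (vsnd (vsnd u)) else vfst (vsnd u));
     return_spmf (guess v = \<beta>)
   }"
    by (simp only: ss_exp_def Let_def if_distrib[of dec_ring, symmetric] stage2)
  also have "\<dots> = bind_spmf ?gen (\<lambda>pk. game par KS A1 A2 \<kappa> pk False)"
    by (simp only: game_def bind_commute_spmf[of coin_spmf ?gen] bind_commute_spmf[of "result A1 _" ?gen])
  finally show ?thesis .
qed

text \<open>A fake oracle ignores the message, so the view can be computed before \<beta> is drawn,
  and a fresh coin equals any fixed guess with probability 1/2. Losslessness makes this an exact
  coin.\<close>

lemma game_True:
  assumes "ppt A1" "ppt A2" "0 < dim (par \<kappa>)" "0 < ctmod (par \<kappa>)" "finite (KS \<kappa>)" "KS \<kappa> \<noteq> {}"
  shows "game par KS A1 A2 \<kappa> pk True = coin_spmf"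
proof -
  let ?O = "kdm_oracle (par \<kappa>) pk True"
  have view: "view (par \<kappa>) (KS \<kappa>) A2 pk ?O st x = view (par \<kappa>) (KS \<kappa>) A2 pk ?O st (Atom 0)" for st x
    by (simp add: view_def kdm_oracle_def)
  have lossless: "lossless_spmf (view (par \<kappa>) (KS \<kappa>) A2 pk ?O st x)" for st x
    using assms finite_ring_mod[OF assms(3,4)] by (simp add: view_def lossless_result)
  have "game par KS A1 A2 \<kappa> pk True = do {
     u \<leftarrow> result A1 (unary \<kappa>);
     \<beta> \<leftarrow> coin_spmf;
     v \<leftarrow> view (par \<kappa>) (KS \<kappa>) A2 pk ?O (vsnd (vsnd (vsnd u))) (Atom 0);
     return_spmf (guess v = \<beta>)
   }"
    unfolding game_def by (subst view) (rule refl)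
  also have "\<dots> = do {
     u \<leftarrow> result A1 (unary \<kappa>);
     v \<leftarrow> view (par \<kappa>) (KS \<kappa>) A2 pk ?O (vsnd (vsnd (vsnd u))) (Atom 0);
     \<beta> \<leftarrow> coin_spmf;
     return_spmf (guess v = \<beta>)
   }"
    by (subst bind_commute_spmf) (rule refl)
  also have "\<dots> = coin_spmf"
    using lossless lossless_result[OF assms(1)]
    by (simp add: bind_coin_spmf_eq_const bind_spmf_const lossless_weight_spmfD)
  finally show ?thesis .
qed

lemma spmf_bind_coin: "spmf (bind_spmf coin_spmf f) x = (spmf (f True) x + spmf (f False) x) / 2"
  by (simp add: spmf_bind integral_spmf_of_set UNIV_bool)

text \<open>With \<open>p\<close> the success probability of the adversary, the reduction is right
  with probability \<open>p\<close> on a real oracle and 1/2 on a fake one, and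
  \<open>(p + 1/2) / 2 - 1/2 = (p - 1/2) / 2\<close>.\<close>

lemma kdm_adv_eq:
  assumes ppt: "ppt cp" "ppt ck" "ppt A1" "ppt A2"
    and cp: "result cp (unary \<kappa>) = return_spmf (enc_list (map Atom
       [dim (par \<kappa>), ptmod (par \<kappa>), ctmod (par \<kappa>), iomod (par \<kappa>), weight (par \<kappa>)]))"
    and ck: "result ck (unary \<kappa>) = spmf_of_set (KS \<kappa>)"
    and pos: "0 < dim (par \<kappa>)" "0 < ctmod (par \<kappa>)"
    and KS: "finite (KS \<kappa>)" "KS \<kappa> \<noteq> {}"
  shows "kdm_adv par (kdm_adversary cp ck A1 A2) \<kappa> = ss_adv par KS A1 A2 \<kappa> / 2"
proof -
  let ?gen = "spmf_of_pmf (map_pmf fst (pke_gen (par \<kappa>)))"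
  let ?G = "\<lambda>\<delta>. bind_spmf ?gen (\<lambda>pk. game par KS A1 A2 \<kappa> pk \<delta>)"
  let ?f = "\<lambda>\<delta>. bind_spmf (?G \<delta>) (\<lambda>w. return_spmf ((\<not> w) = \<delta>))"
  have guess: "guess (Atom (of_bool w)) = w" for w by (simp add: guess_def)
  have "kdm_exp par (kdm_adversary cp ck A1 A2) \<kappa> =
    bind_spmf ?gen (\<lambda>pk. bind_spmf coin_spmf (\<lambda>\<delta>. bind_spmf (game par KS A1 A2 \<kappa> pk \<delta>) (\<lambda>w. return_spmf ((\<not> w) = \<delta>))))"
    unfolding kdm_exp_def
    by (simp add: outcome_kdm_adversary[where par = par and KS = KS, OF ppt cp ck pos] bind_map_spmf bind_map_pmf o_def guess case_prod_unfold
       del: of_bool_not_iff)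
  also have "\<dots> = bind_spmf coin_spmf ?f"
    by (subst bind_commute_spmf) (simp del: bind_spmf_of_pmf)
  finally have E: "spmf (kdm_exp par (kdm_adversary cp ck A1 A2) \<kappa>) True = (spmf (?f True) True + spmf (?f False) True) / 2"
    by (simp only: spmf_bind_coin)
  have G: "?G True = coin_spmf"
    by (simp add: game_True[where par = par and KS = KS, OF ppt(3,4) pos KS] bind_pmf_const)
  have "?f True = bind_spmf coin_spmf (\<lambda>w. return_spmf (\<not> w))" unfolding G by simp
  then have 1: "spmf (?f True) True = 1 / 2" by (simp add: spmf_bind_coin)
  have "?f False = ss_exp par KS A1 A2 \<kappa>" by (simp add: ss_exp_eq[where par = par and KS = KS, OF pos KS])
  with E 1 show ?thesis by (simp add: kdm_adv_def ss_adv_def field_simps abs_if)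
qed

lemma negligible_mult2:
  assumes "negligible f"
  shows "negligible (\<lambda>\<kappa>. 2 * f \<kappa>)"
  unfolding negligible_def
proof
  fix c
  \<comment> \<open>One extra power of \<kappa> absorbs the factor 2 once \<kappa> is at least
    2.\<close>
  have "\<forall>\<^sub>F \<kappa> in sequentially. \<bar>f \<kappa>\<bar> \<le> 1 / real \<kappa> ^ Suc c" using assms unfolding negligible_def by blast
  then show "\<forall>\<^sub>F \<kappa> in sequentially. \<bar>2 * f \<kappa>\<bar> \<le> 1 / real \<kappa> ^ c"
    using eventually_ge_at_top[of 2]
  proof eventually_elim
    case (elim \<kappa>)
    have "2 * (1 / real \<kappa> ^ Suc c) \<le> 1 / real \<kappa> ^ c" using elim(2) by (simp add: field_simps)
    with elim(1) show ?case by simp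
  qed
qed

theorem theorem2:
  fixes par :: "nat \<Rightarrow> params"
    and KS :: "nat \<Rightarrow> val set"
    and F :: "nat \<Rightarrow> val \<Rightarrow> nat \<Rightarrow> int poly \<times> int poly"
  assumes "admissible_params par"
    and "public_params par"
    and "pseudorandom_function par KS F"
    and "kdm_secure par"
  shows "semantically_secure par KS"
  unfolding semantically_secure_def
proof (intro allI impI)
  fix A1 A2 assume "ss_adversary par A1 A2"
  then have A: "ppt A1" "ppt A2" by (simp_all add: ss_adversary_def)
  obtain cp where cp: "ppt cp" "\<And>\<kappa>. result cp (unary \<kappa>) = return_spmf (enc_list (map Atom
       [dim (par \<kappa>), ptmod (par \<kappa>), ctmod (par \<kappa>), iomod (par \<kappa>), weight (par \<kappa>)]))"
    using assms(2) unfolding public_params_def poly_time_computable_def by blast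
  obtain ck where ck: "ppt ck" "\<And>\<kappa>. result ck (unary \<kappa>) = spmf_of_set (KS \<kappa>)"
    using assms(3) unfolding pseudorandom_function_def by blast
  have KS: "finite (KS \<kappa>)" "KS \<kappa> \<noteq> {}" for \<kappa>
    using assms(3) unfolding pseudorandom_function_def by blast+
  have "0 < dim (par \<kappa>)" "0 < ctmod (par \<kappa>)" for \<kappa>
  proof -
    obtain k where "dim (par \<kappa>) = 2 ^ k" using assms(1) unfolding admissible_params_def by blast
    then show "0 < dim (par \<kappa>)" by simp
  qed (use assms(1) in \<open>simp add: admissible_params_def\<close>)
  then have "ss_adv par KS A1 A2 = (\<lambda>\<kappa>. 2 * kdm_adv par (kdm_adversary cp ck A1 A2) \<kappa>)"
    by (simp add: fun_eq_iff kdm_adv_eq[where par = par and KS = KS, OF cp(1) ck(1) A cp(2) ck(2) _ _ KS])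
  moreover have "negligible (kdm_adv par (kdm_adversary cp ck A1 A2))"
    using assms(4) ppt_oracle_kdm_adversary[OF cp(1) ck(1) A] by (simp add: kdm_secure_def)
  ultimately show "negligible (ss_adv par KS A1 A2)" by (simp add: negligible_mult2)
qed

end
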